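(* Let $\mathbb{F}_p$ be the field of prime order $p$ and $\overline{\mathbb{F}}_p$ its algebraic closure, and let $n\geq 3$. Then the geometry $\mathrm{Gr}_{1,n}(A_n(\overline{\mathbb{F}}_p))$ has infinite generating rank, while its embedding rank is equal to either $(n+1)^2-1$ or $(n+1)^2$.
   Context: $\mathrm{Gr}_{1,n}(A_n(\mathbb{K}))$: let $V$ be an $(n+1)$-dimensional vector space over $\mathbb{K}$. Points are the flags $(p,H)$ with $p$ a 1-dimensional subspace, $H$ an $n$-dimensional subspace, $p\subseteq H$. Lines are the sets $\{(p,X): X\supset S, \dim X=n\}$ for $p\subseteq S$, $\dim S=n-1$, and the sets $\{(x,H): \dim x=1, x\subseteq L\}$ for $L\subseteq H$, $\dim L=2$. A subspace of a point-line geometry is a set of points containing all points of every line meeting it in at least two points; the generating rank is the minimum cardinality of a set of points contained in no proper subspace. A (full) projective embedding of a point-line geometry $\Gamma$ is an injective map $e$ from the points of $\Gamma$ to the points of a projective space $\mathrm{PG}(W)$ ($W$ a vector space over some division ring) such that each line of $\Gamma$ is mapped onto a projective line of $\mathrm{PG}(W)$ and the image spans $\mathrm{PG}(W)$; its dimension is $\dim W$. The embedding rank of $\Gamma$ is the supremum of the dimensions of its projective embeddings. *)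

theory Defs
  imports
    "HOL-Algebra.Algebraic_Closure_Type"
    "HOL-Library.Extended_Nat"
    "Berlekamp_Zassenhaus.Finite_Field"
begin

section \<open>Point-line geometries\<close>

record 'a geometry =
  points :: "'a set"
  lines :: "'a set set"

definition geom_subspace :: "'a geometry \<Rightarrow> 'a set \<Rightarrow> bool" where
  "geom_subspace \<Gamma> Y \<longleftrightarrow> Y \<subseteq> points \<Gamma> \<and>
     (\<forall>l\<in>lines \<Gamma>. (\<exists>x\<in>l \<inter> Y. \<exists>y\<in>l \<inter> Y. x \<noteq> y) \<longrightarrow> l \<subseteq> Y)"

definition generates :: "'a geometry \<Rightarrow> 'a set \<Rightarrow> bool" where
  "generates \<Gamma> S \<longleftrightarrow> S \<subseteq> points \<Gamma> \<and>
     (\<forall>Y. geom_subspace \<Gamma> Y \<and> S \<subseteq> Y \<longrightarrow> Y = points \<Gamma>)"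

text \<open>All infinite cardinalities are identified with \<open>\<infinity>\<close>.\<close>

definition ecard :: "'a set \<Rightarrow> enat" where
  "ecard A = (if finite A then enat (card A) else \<infinity>)"

definition generating_rank :: "'a geometry \<Rightarrow> enat" where
  "generating_rank \<Gamma> = (INF S\<in>{S. generates \<Gamma> S}. ecard S)"

section \<open>The geometry of point-hyperplane flags\<close>

text \<open>The parameter \<open>n\<close> is one less than the dimension of the ambient space.\<close>

context vector_space
begin

definition flag_geometry :: "nat \<Rightarrow> ('b set \<times> 'b set) geometry" where
  "flag_geometry n = \<lparr>
     points = {(p, H). subspace p \<and> dim p = 1 \<and> subspace H \<and> dim H = n \<and> p \<subseteq> H},
     lines =
       {{(p, Y) | Y. subspace Y \<and> dim Y = n \<and> S \<subseteq> Y} | p S.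
          subspace p \<and> dim p = 1 \<and> subspace S \<and> dim S = n - 1 \<and> p \<subseteq> S} \<union>
       {{(x, H) | x. subspace x \<and> dim x = 1 \<and> x \<subseteq> L} | L H.
          subspace L \<and> dim L = 2 \<and> subspace H \<and> dim H = n \<and> L \<subseteq> H}\<rparr>"

end

section \<open>Vector spaces over division rings\<close>

text \<open>Both \<open>vector_space\<close> and \<open>module\<close> presuppose commutative scalars, whereas projective
  embeddings may take values in vector spaces over arbitrary division rings. Working with
  explicit carriers makes it possible to quantify over all such structures.\<close>

locale skew_field = ring R for R (structure) +
  assumes one_not_zero: "\<one> \<noteq> \<zero>"
    and nonzero_Units: "\<lbrakk>a \<in> carrier R; a \<noteq> \<zero>\<rbrakk> \<Longrightarrow> a \<in> Units R"

locale left_vector_space = R?: skew_field R + W?: abelian_group W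
  for R :: "('d, 'm) ring_scheme" (structure) and W :: "('d, 'w, 'n) module_scheme" (structure) +
  assumes smult_closed:
      "\<lbrakk>a \<in> carrier R; x \<in> carrier W\<rbrakk> \<Longrightarrow> a \<odot>\<^bsub>W\<^esub> x \<in> carrier W"
    and smult_l_distr:
      "\<lbrakk>a \<in> carrier R; b \<in> carrier R; x \<in> carrier W\<rbrakk>
        \<Longrightarrow> (a \<oplus> b) \<odot>\<^bsub>W\<^esub> x = a \<odot>\<^bsub>W\<^esub> x \<oplus>\<^bsub>W\<^esub> b \<odot>\<^bsub>W\<^esub> x"
    and smult_r_distr:
      "\<lbrakk>a \<in> carrier R; x \<in> carrier W; y \<in> carrier W\<rbrakk>
        \<Longrightarrow> a \<odot>\<^bsub>W\<^esub> (x \<oplus>\<^bsub>W\<^esub> y) = a \<odot>\<^bsub>W\<^esub> x \<oplus>\<^bsub>W\<^esub> a \<odot>\<^bsub>W\<^esub> y"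
    and smult_assoc:
      "\<lbrakk>a \<in> carrier R; b \<in> carrier R; x \<in> carrier W\<rbrakk>
        \<Longrightarrow> (a \<otimes> b) \<odot>\<^bsub>W\<^esub> x = a \<odot>\<^bsub>W\<^esub> (b \<odot>\<^bsub>W\<^esub> x)"
    and smult_one: "x \<in> carrier W \<Longrightarrow> \<one> \<odot>\<^bsub>W\<^esub> x = x"

definition lin_span :: "('d, 'm) ring_scheme \<Rightarrow> ('d, 'w, 'n) module_scheme \<Rightarrow> 'w set \<Rightarrow> 'w set" where
  "lin_span R W A = \<Inter>{U. submodule U R W \<and> A \<subseteq> U}"

definition is_basis ::
  "('d, 'm) ring_scheme \<Rightarrow> ('d, 'w, 'n) module_scheme \<Rightarrow> 'w set \<Rightarrow> 'w set \<Rightarrow> bool" where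
  "is_basis R W U B \<longleftrightarrow> B \<subseteq> U \<and> lin_span R W B = U \<and> (\<forall>b\<in>B. b \<notin> lin_span R W (B - {b}))"

definition lin_dim :: "('d, 'm) ring_scheme \<Rightarrow> ('d, 'w, 'n) module_scheme \<Rightarrow> 'w set \<Rightarrow> enat" where
  "lin_dim R W U = ecard (SOME B. is_basis R W U B)"

section \<open>Projective embeddings\<close>

definition PG :: "('d, 'm) ring_scheme \<Rightarrow> ('d, 'w, 'n) module_scheme \<Rightarrow> 'w set geometry" where
  "PG R W = \<lparr>
     points = {x. submodule x R W \<and> lin_dim R W x = 1},
     lines = {{x. submodule x R W \<and> lin_dim R W x = 1 \<and> x \<subseteq> L} | L.
                submodule L R W \<and> lin_dim R W L = 2}\<rparr>"

definition projective_embedding ::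
  "'a geometry \<Rightarrow> ('d, 'm) ring_scheme \<Rightarrow> ('d, 'w, 'n) module_scheme \<Rightarrow> ('a \<Rightarrow> 'w set) \<Rightarrow> bool" where
  "projective_embedding \<Gamma> R W e \<longleftrightarrow>
     left_vector_space R W \<and>
     e ` points \<Gamma> \<subseteq> points (PG R W) \<and>
     inj_on e (points \<Gamma>) \<and>
     (\<forall>l\<in>lines \<Gamma>. e ` l \<in> lines (PG R W)) \<and>
     lin_span R W (\<Union>(e ` points \<Gamma>)) = carrier W"

text \<open>A supremum in HOL cannot range over all types, so the types \<open>'d\<close> and \<open>'w\<close> from which the
  carriers of the division ring and of the vector space are drawn are parameters. The carriers
  may be arbitrary subsets of these types. If a geometry has at least one line and only
  countably many points, then a division ring over which it embeds and the vector space spanned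
  by its image are countable (a projective line over \<open>R\<close> minus a point is in
  bijection with \<open>R\<close>), so any two infinite types give all embeddings up to isomorphism.\<close>

definition embedding_rank :: "'d itself \<Rightarrow> 'w itself \<Rightarrow> 'a geometry \<Rightarrow> enat" where
  "embedding_rank _ _ \<Gamma> =
     Sup {lin_dim R W (carrier W) | (R :: 'd ring) (W :: ('d, 'w) module) (e :: 'a \<Rightarrow> 'w set).
            projective_embedding \<Gamma> R W e}"

end

theory Submission
  imports
    Defs
    "HOL-Algebra.Multiplicative_Group"
    "HOL-Library.Countable_Set"
    "HOL-Library.Function_Algebras"
begin

text \<open>
  Every finite set of elements of \<open>K\<close>, the algebraic closure of \<open>F\<^sub>p\<close>, lies in a finite subfield
  \<open>F\<^sub>q\<close>, which is the fixed field of a power of the Frobenius and consists of \<open>0\<close> and the powers of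
  one element.

  Generating rank: fix a basis and let \<open>\<sigma>\<close> be the coordinatewise \<open>q\<close>-Frobenius. The flags \<open>(p, H)\<close>
  with \<open>p \<subseteq> U \<subseteq> H\<close> for some \<open>\<sigma>\<close>-stable subspace \<open>U\<close> form a proper subspace of the geometry, because
  \<open>\<sigma>\<close>-stable subspaces are closed under intersections and sums. It contains all flags whose point is
  spanned by a vector with coordinates in \<open>F\<^sub>q\<close>, so no finite set of flags generates.

  Upper bound: write a flag as a pair \<open>(v, f)\<close> of a vector and a linear form. In a subspace \<open>Y\<close> of the
  geometry, the forms paired with a vector and the vectors paired with a form are linear spaces.
  Let \<open>e\<^sub>i\<close> be a basis with
  dual basis \<open>\<epsilon>\<^sub>i\<close>. Suppose that \<open>Y\<close> contains \<open>(e\<^sub>i, \<epsilon>\<^sub>j)\<close> for all \<open>i \<noteq> j\<close>. Then the \<open>a\<close> with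
  \<open>(e\<^sub>i + a e\<^sub>j, a \<epsilon>\<^sub>i - \<epsilon>\<^sub>j)\<close> in \<open>Y\<close> for all \<open>i \<noteq> j\<close> are closed under multiplication, and \<open>Y\<close> contains
  all \<open>(v, f)\<close> for which the ratios of the coordinates of \<open>v\<close> are such \<open>a\<close>. Hence any finite set
  of flags depends on \<open>(n + 1)\<^sup>2\<close> flags: the pairs above, the pairs \<open>(e\<^sub>0 + e\<^sub>j, \<epsilon>\<^sub>0 - \<epsilon>\<^sub>j)\<close> and one more
  involving a generator \<open>t\<close> of a large enough \<open>F\<^sub>q\<close>. Preimages of linear subspaces under an embedding
  are subspaces of the geometry, so \<open>(n + 1)\<^sup>2 + 1\<close> independent vectors in the span of
  the image are impossible.

  Lower bound: \<open>(\<langle>v\<rangle>, ker f) \<mapsto> \<langle>v \<otimes> f\<rangle>\<close> is an embedding into the traceless matrices.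
\<close>

section \<open>The algebraic closure of a prime field\<close>

text \<open>Applied to the remainders modulo a fixed polynomial over the prime field.\<close>

lemma finite_bounded_degree_polys:
  "finite {f :: 'a::{finite,comm_semiring_0} poly. \<forall>i\<ge>d. poly.coeff f i = 0}"
proof -
  have "finite (Poly ` {xs :: 'a list. set xs \<subseteq> UNIV \<and> length xs = d})"
    by (intro finite_imageI finite_lists_length_eq) auto
  moreover have "f \<in> Poly ` {xs. set xs \<subseteq> UNIV \<and> length xs = d}"
    if "\<forall>i\<ge>d. poly.coeff f i = 0" for f :: "'a poly"
  proof
    show "f = Poly (map (poly.coeff f) [0..<d])"
      using that by (intro poly_eqI) (auto simp: nth_default_def)
  qed auto
  ultimately show ?thesis by (auto elim: finite_subset[rotated])
qed

text \<open>By additivity of the Frobenius a power of \<open>x - y\<close> vanishes, hence so does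
  \<open>x - y\<close>.\<close>

lemma frobenius_inj:
  fixes x y :: "'a::idom"
  assumes "prime CHAR('a)" "x ^ (CHAR('a) ^ i) = y ^ (CHAR('a) ^ i)"
  shows "x = y"
proof -
  have "(x - y) ^ (CHAR('a) ^ i) + y ^ (CHAR('a) ^ i) = x ^ (CHAR('a) ^ i)"
    using freshmans_dream'[OF assms(1) refl, of "x - y" y i] by simp
  with assms(2) have "(x - y) ^ (CHAR('a) ^ i) = 0" by simp
  thus ?thesis by simp
qed

lemma frobenius_power_fixes:
  fixes x :: "'a::monoid_mult"
  assumes "x ^ (q ^ m) = x"
  shows "x ^ (q ^ (m * k)) = x"
proof (induction k)
  case (Suc k)
  have "x ^ (q ^ (m * Suc k)) = (x ^ (q ^ m)) ^ (q ^ (m * k))"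
    by (simp add: power_add flip: power_mult)
  thus ?case using assms Suc by simp
qed simp

text \<open>Reducing monomials modulo an annihilating polynomial shows that \<open>x\<close> has
  only finitely many powers. So two Frobenius iterates of \<open>x\<close> agree, and injectivity of
  the Frobenius cancels the smaller one.\<close>

lemma alg_closure_finite_field_frobenius_fixes:
  fixes x :: "'p::prime_card mod_ring alg_closure"
  shows "\<exists>m>0. x ^ (CARD('p) ^ m) = x"
proof -
  obtain g :: "'p mod_ring poly" where g: "g \<noteq> 0" "poly (map_poly to_ac g) x = 0"
    by (rule alg_closure_algebraic)
  define ev where "ev = (\<lambda>f :: 'p mod_ring poly. poly (map_poly to_ac f) x)"
  have ev_add: "ev (f + h) = ev f + ev h" for f h
    unfolding ev_def by (subst map_poly_add) auto
  have ev_mult: "ev (f * h) = ev f * ev h" for f h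
  proof -
    have "map_poly to_ac (f * h) = map_poly to_ac f * map_poly to_ac h"
      by (intro poly_eqI) (simp add: coeff_map_poly coeff_mult to_ac_sum)
    thus ?thesis by (simp add: ev_def)
  qed
  have ev_monom: "ev (Polynomial.monom 1 k) = x ^ k" for k
    unfolding ev_def by (subst map_poly_monom) (auto simp: poly_monom)
  define P where "P = {f :: 'p mod_ring poly. \<forall>i\<ge>Suc (Polynomial.degree g). poly.coeff f i = 0}"
  have "finite P" unfolding P_def by (rule finite_bounded_degree_polys)
  have "x ^ k \<in> ev ` P" for k
  proof
    have "ev (Polynomial.monom 1 k) =
        ev (Polynomial.monom 1 k div g * g + Polynomial.monom 1 k mod g)" by simp
    also have "\<dots> = ev (Polynomial.monom 1 k mod g)"
      using g by (simp only: ev_add ev_mult) (simp add: ev_def)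
    finally show "x ^ k = ev (Polynomial.monom 1 k mod g)" by (simp add: ev_monom)
    show "Polynomial.monom 1 k mod g \<in> P"
      using degree_mod_less[OF g(1), of "Polynomial.monom 1 k"] unfolding P_def
      by (auto intro: Polynomial.coeff_eq_0)
  qed
  hence "finite (range (\<lambda>i::nat. x ^ (CARD('p) ^ i)))"
    using \<open>finite P\<close> by (meson finite_imageI finite_subset image_subsetI)
  hence "\<not> inj (\<lambda>i::nat. x ^ (CARD('p) ^ i))"
    using finite_imageD infinite_UNIV_nat by blast
  then obtain i j where ij: "x ^ (CARD('p) ^ i) = x ^ (CARD('p) ^ j)" "i < j"
    unfolding inj_def by (metis linorder_neqE_nat)
  have "x ^ (CARD('p) ^ j) = (x ^ (CARD('p) ^ (j - i))) ^ (CARD('p) ^ i)"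
    using ij(2) by (simp flip: power_mult power_add)
  hence "x = x ^ (CARD('p) ^ (j - i))"
    using frobenius_inj[of x i] ij(1) prime_card[where 'a='p] by simp
  thus ?thesis using ij(2) by (metis zero_less_diff)
qed

text \<open>If \<open>m\<close> works for some elements and \<open>k\<close> for one more, then
  \<open>m * k\<close> works for all of them, since iterates of a map fixing an element still fix
  it.\<close>

lemma finite_frobenius_fixes:
  fixes S :: "'p::prime_card mod_ring alg_closure set"
  assumes "finite S"
  shows "\<exists>m>0. \<forall>x\<in>S. x ^ (CARD('p) ^ m) = x"
  using assms
proof induction
  case (insert x S)
  then obtain m where m: "m > 0" "\<forall>x\<in>S. x ^ (CARD('p) ^ m) = x" by blast
  obtain k where k: "k > 0" "x ^ (CARD('p) ^ k) = x"
    using alg_closure_finite_field_frobenius_fixes by blast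
  have "\<forall>y\<in>insert x S. y ^ (CARD('p) ^ (m * k)) = y"
    using frobenius_power_fixes m k by (metis insert_iff mult.commute)
  thus ?case using m(1) k(1) by (metis nat_0_less_mult_iff)
qed auto

lemma finite_frobenius_fixed:
  fixes q :: nat
  assumes "q > 1"
  shows "finite {x :: 'a::idom. x ^ q = x}"
proof -
  let ?f = "Polynomial.monom 1 q - Polynomial.monom 1 1 :: 'a poly"
  have "poly.coeff ?f q = 1" using assms by simp
  hence "?f \<noteq> 0" by (metis coeff_0 zero_neq_one)
  hence "finite {x. poly ?f x = 0}" by (rule poly_roots_finite)
  thus ?thesis by (simp add: poly_monom)
qed

text \<open>A finite subset closed under the field operations becomes a field with explicit carrier,
  to which the cyclicity of the multiplicative group applies.\<close>

lemma finite_field_generator: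
  fixes F :: "'a::field set"
  assumes "finite F" "1 \<in> F" "0 \<in> F" "\<And>x y. x \<in> F \<Longrightarrow> y \<in> F \<Longrightarrow> x + y \<in> F"
    "\<And>x y. x \<in> F \<Longrightarrow> y \<in> F \<Longrightarrow> x * y \<in> F" "\<And>x. x \<in> F \<Longrightarrow> - x \<in> F"
    "\<And>x. x \<in> F \<Longrightarrow> inverse x \<in> F"
  shows "\<exists>t\<in>F. \<forall>x\<in>F. x \<noteq> 0 \<longrightarrow> (\<exists>i::nat. x = t ^ i)"
proof -
  define R where "R = (ring_of_type_algebra :: 'a ring) \<lparr>carrier := F\<rparr>"
  have R: "carrier R = F" "monoid.mult R = (*)" "monoid.one R = 1" "ring.zero R = 0" "ring.add R = (+)"
    by (simp_all add: R_def ring_of_type_algebra_def)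
  interpret R: field R
  proof (rule cring.cring_fieldI)
    have "\<exists>y\<in>F. y + x = 0" if "x \<in> F" for x
      using that assms(6) by (intro bexI[of _ "- x"]) auto
    thus "cring R"
      by (intro cringI abelian_groupI comm_monoidI) (auto simp: R assms algebra_simps)
    show "Units R = carrier R - {\<zero>\<^bsub>R\<^esub>}"
    proof (intro equalityI subsetI)
      fix x assume "x \<in> carrier R - {\<zero>\<^bsub>R\<^esub>}"
      hence x: "x \<in> F - {0}" by (simp add: R)
      hence "inverse x \<in> F" "x * inverse x = 1" "inverse x * x = 1" using assms by auto
      with x show "x \<in> Units R"
        unfolding Units_def by (auto simp: R intro!: bexI[of _ "inverse x"])
    qed (auto simp: Units_def R)
  qed
  obtain t where t: "t \<in> carrier (mult_of R)"
      "carrier (mult_of R) = {t [^]\<^bsub>R\<^esub> i | i::nat. i \<in> UNIV}"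
    using R.finite_field_mult_group_has_gen assms(1) R by auto
  have "t [^]\<^bsub>R\<^esub> i = t ^ i" for i :: nat
    by (induction i) (simp_all add: R mult.commute)
  with t have "F - {0} = {t ^ i | i::nat. i \<in> UNIV}" "t \<in> F" by (auto simp: R)
  thus ?thesis by blast
qed

lemma frobenius_fixed_generator:
  assumes "m > 0"
  shows "\<exists>t :: 'p::prime_card mod_ring alg_closure. \<forall>x. x ^ (CARD('p) ^ m) = x \<longrightarrow>
    x = 0 \<or> (\<exists>i. x = t ^ i)"
proof -
  let ?q = "CARD('p) ^ m"
  have p: "prime CARD('p)" by (rule prime_card)
  hence q: "?q > 1" using assms by (intro one_less_power prime_gt_1_nat)
  have add: "(x + y) ^ ?q = x ^ ?q + y ^ ?q" for x y :: "'p mod_ring alg_closure"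
    by (rule freshmans_dream') (simp_all add: p)
  have "\<exists>t\<in>{x :: 'p mod_ring alg_closure. x ^ ?q = x}.
      \<forall>x\<in>{x. x ^ ?q = x}. x \<noteq> 0 \<longrightarrow> (\<exists>i::nat. x = t ^ i)"
  proof (rule finite_field_generator)
    show "finite {x :: 'p mod_ring alg_closure. x ^ ?q = x}"
      using q by (rule finite_frobenius_fixed)
    show "- x \<in> {x. x ^ ?q = x}" if "x \<in> {x. x ^ ?q = x}" for x :: "'p mod_ring alg_closure"
    proof -
      \<comment> \<open>Additivity yields the sign rule without a case distinction for
        characteristic 2.\<close>
      have "0 = (x + - x) ^ ?q" using q by simp
      also have "\<dots> = x ^ ?q + (- x) ^ ?q" by (rule add)
      finally show ?thesis using that by (simp add: eq_neg_iff_add_eq_0 add.commute)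
    qed
  qed (use q in \<open>auto simp: add power_mult_distrib power_inverse\<close>)
  thus ?thesis by blast
qed

text \<open>Euclid's argument: the product of all \<open>X - a\<close>, plus 1, would have positive
  degree but take the value 1 everywhere.\<close>

lemma infinite_UNIV_alg_closed_field: "infinite (UNIV :: 'a::alg_closed_field set)"
proof
  assume fin: "finite (UNIV :: 'a set)"
  let ?f = "(\<Prod>a\<in>UNIV. [:- a, 1:]) + 1 :: 'a poly"
  have "Polynomial.degree (\<Prod>a\<in>UNIV. [:- a, 1:] :: 'a poly) = card (UNIV :: 'a set)"
    by (subst degree_prod_eq_sum_degree) auto
  hence "Polynomial.degree ?f > 0"
    using fin by (simp add: degree_add_eq_left card_gt_0_iff)
  then obtain x where "poly ?f x = 0"
    using alg_closed_imp_poly_has_root by blast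
  moreover have "(\<Prod>a\<in>UNIV. x - a) = 0" using fin by (intro prod_zero) auto
  ultimately show False by (simp add: poly_prod)
qed

text \<open>The closure is a countable union of finite fixed fields of Frobenius powers. This lets
  the traceless embedding be copied into arbitrary infinite types.\<close>

lemma countable_UNIV_alg_closure_finite:
  "countable (UNIV :: 'p::prime_card mod_ring alg_closure set)"
proof (rule countable_subset)
  show "UNIV \<subseteq> (\<Union>m\<in>{0<..}. {x :: 'p mod_ring alg_closure. x ^ (CARD('p) ^ m) = x})"
    using alg_closure_finite_field_frobenius_fixes by fastforce
  show "countable (\<Union>m\<in>{0<..}. {x :: 'p mod_ring alg_closure. x ^ (CARD('p) ^ m) = x})"
    by (intro countable_UN[OF countableI_type] countable_finite finite_frobenius_fixed
        one_less_power prime_gt_1_nat prime_card) auto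
qed

section \<open>Linear algebra over division rings\<close>

context left_vector_space
begin

section \<open>Submodules and linear spans\<close>

lemma smult_zero_left: "x \<in> carrier W \<Longrightarrow> \<zero> \<odot>\<^bsub>W\<^esub> x = \<zero>\<^bsub>W\<^esub>"
  by (metis R.r_zero R.zero_closed W.add.r_cancel_one smult_closed smult_l_distr)

lemma smult_minus_one: "x \<in> carrier W \<Longrightarrow> (\<ominus> \<one>) \<odot>\<^bsub>W\<^esub> x = \<ominus>\<^bsub>W\<^esub> x"
  by (metis R.add.inv_closed R.l_neg R.one_closed W.minus_equality smult_closed smult_l_distr
      smult_one smult_zero_left)

lemma submodule_carrier: "submodule U R W \<Longrightarrow> U \<subseteq> carrier W"
  using subgroup.subset[of U "add_monoid W"] by (auto dest: submodule.axioms)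

lemma submodule_zero: "submodule U R W \<Longrightarrow> \<zero>\<^bsub>W\<^esub> \<in> U"
  using subgroup.one_closed[of U "add_monoid W"] by (auto dest: submodule.axioms)

lemma submodule_add: "submodule U R W \<Longrightarrow> x \<in> U \<Longrightarrow> y \<in> U \<Longrightarrow> x \<oplus>\<^bsub>W\<^esub> y \<in> U"
  using subgroup.m_closed[of U "add_monoid W"] by (auto dest: submodule.axioms)

lemma submodule_smult: "submodule U R W \<Longrightarrow> a \<in> carrier R \<Longrightarrow> x \<in> U \<Longrightarrow> a \<odot>\<^bsub>W\<^esub> x \<in> U"
  by (rule submodule.smult_closed)

lemma submoduleI:
  assumes "U \<subseteq> carrier W" "\<zero>\<^bsub>W\<^esub> \<in> U" "\<And>x y. x \<in> U \<Longrightarrow> y \<in> U \<Longrightarrow> x \<oplus>\<^bsub>W\<^esub> y \<in> U"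
    "\<And>a x. a \<in> carrier R \<Longrightarrow> x \<in> U \<Longrightarrow> a \<odot>\<^bsub>W\<^esub> x \<in> U"
  shows "submodule U R W"
proof (intro submodule.intro subgroup.intro submodule_axioms.intro)
  fix x assume x: "x \<in> U"
  have "\<ominus>\<^bsub>W\<^esub> x = (\<ominus> \<one>) \<odot>\<^bsub>W\<^esub> x" using x assms(1) smult_minus_one by auto
  thus "inv\<^bsub>add_monoid W\<^esub> x \<in> U" using assms(4)[OF _ x] by (simp add: a_inv_def)
qed (use assms in auto)

lemma submodule_whole: "submodule (carrier W) R W"
  by (rule submoduleI) (auto simp: smult_closed)

lemma submodule_lin_span: "A \<subseteq> carrier W \<Longrightarrow> submodule (lin_span R W A) R W"
  using submodule_whole unfolding lin_span_def
  by (intro submoduleI) (auto simp: submodule_zero submodule_add submodule_smult)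

lemma lin_span_superset: "A \<subseteq> lin_span R W A"
  by (auto simp: lin_span_def)

lemma lin_span_minimal: "submodule U R W \<Longrightarrow> A \<subseteq> U \<Longrightarrow> lin_span R W A \<subseteq> U"
  by (auto simp: lin_span_def)

lemma lin_span_mono: "A \<subseteq> B \<Longrightarrow> lin_span R W A \<subseteq> lin_span R W B"
  by (auto simp: lin_span_def)

lemma lin_span_carrier: "A \<subseteq> carrier W \<Longrightarrow> lin_span R W A \<subseteq> carrier W"
  by (rule lin_span_minimal[OF submodule_whole])

lemma lin_span_subset_lin_span:
  "B \<subseteq> carrier W \<Longrightarrow> A \<subseteq> lin_span R W B \<Longrightarrow> lin_span R W A \<subseteq> lin_span R W B"
  by (rule lin_span_minimal[OF submodule_lin_span])

lemma lin_span_insert: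
  assumes x: "x \<in> carrier W" and A: "A \<subseteq> carrier W"
  shows "lin_span R W (insert x A) = {a \<odot>\<^bsub>W\<^esub> x \<oplus>\<^bsub>W\<^esub> s | a s. a \<in> carrier R \<and> s \<in> lin_span R W A}"
    (is "_ = ?U")
proof
  have sA: "submodule (lin_span R W A) R W" by (rule submodule_lin_span[OF A])
  have c: "s \<in> carrier W" if "s \<in> lin_span R W A" for s
    using that lin_span_carrier[OF A] by auto
  have "submodule ?U R W"
  proof (rule submoduleI)
    show "?U \<subseteq> carrier W" using x c by (auto simp: smult_closed)
    have "\<zero>\<^bsub>W\<^esub> = \<zero> \<odot>\<^bsub>W\<^esub> x \<oplus>\<^bsub>W\<^esub> \<zero>\<^bsub>W\<^esub>" using x by (simp add: smult_zero_left)
    thus "\<zero>\<^bsub>W\<^esub> \<in> ?U" using submodule_zero[OF sA] by blast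
  next
    fix y z assume "y \<in> ?U" "z \<in> ?U"
    then obtain a b s t where *: "y = a \<odot>\<^bsub>W\<^esub> x \<oplus>\<^bsub>W\<^esub> s" "z = b \<odot>\<^bsub>W\<^esub> x \<oplus>\<^bsub>W\<^esub> t" "a \<in> carrier R"
      "b \<in> carrier R" "s \<in> lin_span R W A" "t \<in> lin_span R W A" by blast
    have "y \<oplus>\<^bsub>W\<^esub> z = (a \<oplus> b) \<odot>\<^bsub>W\<^esub> x \<oplus>\<^bsub>W\<^esub> (s \<oplus>\<^bsub>W\<^esub> t)"
      using * x c by (simp add: smult_l_distr smult_closed W.a_ac)
    moreover have "s \<oplus>\<^bsub>W\<^esub> t \<in> lin_span R W A" using submodule_add[OF sA] * by blast
    ultimately show "y \<oplus>\<^bsub>W\<^esub> z \<in> ?U" using * by blast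
  next
    fix b y assume b: "b \<in> carrier R" and "y \<in> ?U"
    then obtain a s where *: "y = a \<odot>\<^bsub>W\<^esub> x \<oplus>\<^bsub>W\<^esub> s" "a \<in> carrier R" "s \<in> lin_span R W A" by blast
    have "b \<odot>\<^bsub>W\<^esub> y = (b \<otimes> a) \<odot>\<^bsub>W\<^esub> x \<oplus>\<^bsub>W\<^esub> b \<odot>\<^bsub>W\<^esub> s"
      using * x c b by (simp add: smult_r_distr smult_closed smult_assoc)
    moreover have "b \<odot>\<^bsub>W\<^esub> s \<in> lin_span R W A" using submodule_smult[OF sA b] * by blast
    ultimately show "b \<odot>\<^bsub>W\<^esub> y \<in> ?U" using * b by blast
  qed
  moreover have "x \<in> ?U"
  proof -
    have "x = \<one> \<odot>\<^bsub>W\<^esub> x \<oplus>\<^bsub>W\<^esub> \<zero>\<^bsub>W\<^esub>" using x by (simp add: smult_one)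
    thus ?thesis using submodule_zero[OF sA] by blast
  qed
  moreover have "A \<subseteq> ?U"
  proof
    fix y assume y: "y \<in> A"
    hence "y = \<zero> \<odot>\<^bsub>W\<^esub> x \<oplus>\<^bsub>W\<^esub> y" using x A by (auto simp: smult_zero_left)
    thus "y \<in> ?U" using y lin_span_superset[of A] by blast
  qed
  ultimately show "lin_span R W (insert x A) \<subseteq> ?U" by (intro lin_span_minimal) auto
  have "submodule (lin_span R W (insert x A)) R W"
    using x A by (intro submodule_lin_span) auto
  moreover have "lin_span R W A \<subseteq> lin_span R W (insert x A)" "x \<in> lin_span R W (insert x A)"
    using lin_span_mono[of A "insert x A"] lin_span_superset[of "insert x A"] by auto
  ultimately show "?U \<subseteq> lin_span R W (insert x A)"
    by (auto intro!: submodule_add submodule_smult)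
qed

text \<open>The coefficient of \<open>x\<close> in \<open>y\<close> is nonzero, for otherwise
  \<open>y\<close> would lie in the span of \<open>A\<close>. Multiplying by its inverse on the left
  solves for \<open>x\<close> even when scalars do not commute.\<close>

lemma lin_span_exchange:
  assumes x: "x \<in> carrier W" and A: "A \<subseteq> carrier W"
    and y: "y \<in> lin_span R W (insert x A)" "y \<notin> lin_span R W A"
  shows "x \<in> lin_span R W (insert y A)"
proof -
  obtain a s where *: "y = a \<odot>\<^bsub>W\<^esub> x \<oplus>\<^bsub>W\<^esub> s" "a \<in> carrier R" "s \<in> lin_span R W A"
    using y(1) lin_span_insert[OF x A] by auto
  have s: "s \<in> carrier W" using * lin_span_carrier[OF A] by auto
  have "a \<noteq> \<zero>" using * y(2) x s by (auto simp: smult_zero_left)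
  hence a: "inv a \<in> carrier R" "inv a \<otimes> a = \<one>" using nonzero_Units[OF *(2)] by auto
  have yc: "y \<in> carrier W" using * x s smult_closed by auto
  have sub: "submodule (lin_span R W (insert y A)) R W"
    using A yc by (intro submodule_lin_span) auto
  have "y \<in> lin_span R W (insert y A)" "s \<in> lin_span R W (insert y A)"
    using *(3) lin_span_mono[of A "insert y A"] lin_span_superset[of "insert y A"] by auto
  hence "inv a \<odot>\<^bsub>W\<^esub> (y \<oplus>\<^bsub>W\<^esub> (\<ominus> \<one>) \<odot>\<^bsub>W\<^esub> s) \<in> lin_span R W (insert y A)"
    using a by (intro submodule_smult[OF sub] submodule_add[OF sub]) auto
  also have "y \<oplus>\<^bsub>W\<^esub> (\<ominus> \<one>) \<odot>\<^bsub>W\<^esub> s = a \<odot>\<^bsub>W\<^esub> x"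
    using s x * smult_closed by (simp add: smult_minus_one W.a_assoc W.r_neg)
  also have "inv a \<odot>\<^bsub>W\<^esub> (a \<odot>\<^bsub>W\<^esub> x) = x"
    using a x * by (simp add: smult_one flip: smult_assoc)
  finally show ?thesis .
qed

text \<open>The vectors lying in spans of finite subsets of \<open>A\<close> already form a
  submodule, because two finite subsets can be united.\<close>

lemma lin_span_finitary:
  assumes A: "A \<subseteq> carrier W" and y: "y \<in> lin_span R W A"
  shows "\<exists>F\<subseteq>A. finite F \<and> y \<in> lin_span R W F"
proof -
  let ?U = "{y. \<exists>F\<subseteq>A. finite F \<and> y \<in> lin_span R W F}"
  have sub: "submodule (lin_span R W F) R W" if "F \<subseteq> A" for F
    using that A by (intro submodule_lin_span) auto
  have "submodule ?U R W"
  proof (rule submoduleI)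
    show "?U \<subseteq> carrier W" using A lin_span_carrier by blast
    show "\<zero>\<^bsub>W\<^esub> \<in> ?U" using submodule_zero[OF sub[of "{}"]] by blast
  next
    fix x y assume "x \<in> ?U" "y \<in> ?U"
    then obtain F G where *: "F \<subseteq> A" "finite F" "x \<in> lin_span R W F" "G \<subseteq> A" "finite G"
      "y \<in> lin_span R W G" by blast
    hence "x \<in> lin_span R W (F \<union> G)" "y \<in> lin_span R W (F \<union> G)"
      using lin_span_mono[of F "F \<union> G"] lin_span_mono[of G "F \<union> G"] by auto
    hence "x \<oplus>\<^bsub>W\<^esub> y \<in> lin_span R W (F \<union> G)" using * by (intro submodule_add[OF sub]) auto
    thus "x \<oplus>\<^bsub>W\<^esub> y \<in> ?U" using * by (intro CollectI exI[of _ "F \<union> G"]) auto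
  qed (use sub submodule_smult in blast)
  moreover have "A \<subseteq> ?U"
  proof
    fix a assume "a \<in> A"
    thus "a \<in> ?U" using lin_span_superset[of "{a}"] by (intro CollectI exI[of _ "{a}"]) auto
  qed
  ultimately show ?thesis using y lin_span_minimal by blast
qed

section \<open>Linear independence, bases and dimension\<close>

definition lin_indep :: "'w set \<Rightarrow> bool" where
  "lin_indep I \<longleftrightarrow> I \<subseteq> carrier W \<and> (\<forall>b\<in>I. b \<notin> lin_span R W (I - {b}))"

lemma lin_indep_mono: "lin_indep I \<Longrightarrow> J \<subseteq> I \<Longrightarrow> lin_indep J"
  unfolding lin_indep_def using lin_span_mono by (meson Diff_mono order_refl subset_iff)

lemma lin_indep_insert:
  assumes I: "lin_indep I" and x: "x \<in> carrier W" "x \<notin> lin_span R W I"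
  shows "lin_indep (insert x I)"
  unfolding lin_indep_def
proof (intro conjI ballI)
  have Ic: "I \<subseteq> carrier W" using I by (simp add: lin_indep_def)
  show "insert x I \<subseteq> carrier W" using x Ic by simp
  have xI: "x \<notin> I" using x lin_span_superset[of I] by auto
  fix b assume b: "b \<in> insert x I"
  show "b \<notin> lin_span R W (insert x I - {b})"
  proof (cases "b = x")
    case True
    thus ?thesis using x xI by simp
  next
    case False
    hence bI: "b \<in> I" using b by simp
    show ?thesis
    proof
      assume "b \<in> lin_span R W (insert x I - {b})"
      hence "b \<in> lin_span R W (insert x (I - {b}))" using False by (simp add: insert_Diff_if)
      moreover have "b \<notin> lin_span R W (I - {b})" using I bI by (simp add: lin_indep_def)
      moreover have "I - {b} \<subseteq> carrier W" using Ic by blast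
      ultimately have "x \<in> lin_span R W (insert b (I - {b}))"
        using lin_span_exchange[OF x(1)] by blast
      thus False using x bI by (simp add: insert_absorb)
    qed
  qed
qed

text \<open>Steinitz exchange: each element of \<open>I\<close> outside \<open>S\<close> is traded
  for an element of \<open>S\<close>, keeping independence and cardinality, until \<open>I\<close>
  is contained in \<open>S\<close>.\<close>

lemma lin_indep_card_le_finite:
  assumes "finite S" "S \<subseteq> carrier W" "finite I" "lin_indep I" "I \<subseteq> lin_span R W S"
  shows "card I \<le> card S"
  using assms(3-5)
proof (induction "card (I - S)" arbitrary: I rule: less_induct)
  case less
  show ?case
  proof (cases "I \<subseteq> S")
    case True
    thus ?thesis using assms(1) card_mono by blast
  next
    case False
    then obtain b where b: "b \<in> I" "b \<notin> S" by blast
    have Ic: "I - {b} \<subseteq> carrier W" using less.prems by (auto simp: lin_indep_def)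
    \<comment> \<open>Otherwise \<open>b\<close>, which lies in the span of \<open>S\<close>, would
      lie in the span of \<open>I - {b}\<close>, against independence.\<close>
    have "\<not> S \<subseteq> lin_span R W (I - {b})"
      using lin_span_subset_lin_span[OF Ic, of S] b less.prems by (auto simp: lin_indep_def)
    then obtain s where s: "s \<in> S" "s \<notin> lin_span R W (I - {b})" by blast
    have sI: "s \<notin> I - {b}" using s lin_span_superset[of "I - {b}"] by blast
    have "card (insert s (I - {b})) \<le> card S"
    proof (rule less.hyps)
      have "insert s (I - {b}) - S = (I - S) - {b}" using s b by auto
      moreover have "card ((I - S) - {b}) < card (I - S)"
        using b less.prems by (intro card_Diff1_less) auto
      ultimately show "card (insert s (I - {b}) - S) < card (I - S)" by simp
      have "lin_indep (I - {b})" using lin_indep_mono[OF less.prems(2)] by blast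
      thus "lin_indep (insert s (I - {b}))"
        using s assms(2) lin_indep_insert by blast
      show "insert s (I - {b}) \<subseteq> lin_span R W S"
        using s less.prems lin_span_superset[of S] by blast
    qed (use less.prems in auto)
    moreover have "card (insert s (I - {b})) = card I"
      using sI card.remove[OF less.prems(1) b(1)] less.prems(1) by simp
    ultimately show ?thesis by simp
  qed
qed

lemma lin_indep_card_le:
  assumes "finite S" "S \<subseteq> carrier W" "lin_indep I" "I \<subseteq> lin_span R W S"
  shows "finite I \<and> card I \<le> card S"
proof -
  have *: "finite J \<Longrightarrow> J \<subseteq> I \<Longrightarrow> card J \<le> card S" for J
    using lin_indep_card_le_finite[OF assms(1,2), of J] assms lin_indep_mono by blast
  have "finite I"
  proof (rule ccontr)
    assume "infinite I"
    then obtain J where "J \<subseteq> I" "finite J" "card J = Suc (card S)"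
      using infinite_arbitrarily_large by metis
    with *[of J] show False by simp
  qed
  with * show ?thesis by blast
qed

lemma is_basis_iff:
  assumes "submodule U R W"
  shows "is_basis R W U B \<longleftrightarrow> lin_indep B \<and> lin_span R W B = U"
  using submodule_carrier[OF assms] lin_span_superset[of B]
  unfolding is_basis_def lin_indep_def by blast

text \<open>Zorn's lemma gives a maximal independent subset, and a vector outside its span could be
  added to it.\<close>

lemma basis_exists:
  assumes U: "submodule U R W"
  shows "\<exists>B. is_basis R W U B"
proof -
  have "\<exists>M\<in>{I. I \<subseteq> U \<and> lin_indep I}. \<forall>J\<in>{I. I \<subseteq> U \<and> lin_indep I}. M \<subseteq> J \<longrightarrow> J = M"
  proof (rule subset_Zorn')
    fix C assume C: "subset.chain {I. I \<subseteq> U \<and> lin_indep I} C"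
    have "lin_indep (\<Union>C)"
      unfolding lin_indep_def
    proof (intro conjI ballI notI)
      show CW: "\<Union>C \<subseteq> carrier W" using C by (auto simp: subset.chain_def lin_indep_def)
      fix b assume b: "b \<in> \<Union>C" and sp: "b \<in> lin_span R W (\<Union>C - {b})"
      \<comment> \<open>A dependence in the union involves finitely many vectors, so it already
        occurs in one member of the chain.\<close>
      then obtain F where F: "F \<subseteq> \<Union>C - {b}" "finite F" "b \<in> lin_span R W F"
        using lin_span_finitary[of "\<Union>C - {b}" b] CW by blast
      have "finite (insert b F)" "insert b F \<subseteq> \<Union>C" "C \<noteq> {}" using F b by auto
      then obtain I where I: "I \<in> C" "insert b F \<subseteq> I"
        using finite_subset_Union_chain[OF _ _ _ C] by metis
      have "F \<subseteq> I - {b}" using F I by auto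
      hence "b \<in> lin_span R W (I - {b})" using F(3) lin_span_mono by blast
      moreover have "lin_indep I" using I C by (auto simp: subset.chain_def)
      ultimately show False using I by (auto simp: lin_indep_def)
    qed
    moreover have "\<Union>C \<subseteq> U" using C by (auto simp: subset.chain_def)
    ultimately show "\<Union>C \<in> {I. I \<subseteq> U \<and> lin_indep I}" by simp
  qed
  then obtain B where B: "B \<subseteq> U" "lin_indep B"
    "\<And>J. J \<subseteq> U \<Longrightarrow> lin_indep J \<Longrightarrow> B \<subseteq> J \<Longrightarrow> J = B"
    by (elim bexE) (simp, blast)
  have "U \<subseteq> lin_span R W B"
  proof
    fix x assume x: "x \<in> U"
    show "x \<in> lin_span R W B"
    proof (rule ccontr)
      assume n: "x \<notin> lin_span R W B"
      have "lin_indep (insert x B)"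
        using x n B(2) submodule_carrier[OF U] by (intro lin_indep_insert) auto
      hence "insert x B = B" using B x by blast
      thus False using n lin_span_superset[of B] by blast
    qed
  qed
  hence "is_basis R W U B" using is_basis_iff[OF U] B lin_span_minimal[OF U] by blast
  thus ?thesis by blast
qed

lemma lin_dim_basis:
  assumes "submodule U R W"
  shows "\<exists>B. is_basis R W U B \<and> lin_dim R W U = ecard B"
  using someI_ex[OF basis_exists[OF assms]] unfolding lin_dim_def by blast

text \<open>The dimension is taken from an arbitrarily chosen basis; exchange in both directions
  compares that basis with \<open>B\<close>.\<close>

lemma lin_dim_eq_card:
  assumes "is_basis R W U B" "finite B" "submodule U R W"
  shows "lin_dim R W U = enat (card B)"
proof -
  obtain C where C: "is_basis R W U C" "lin_dim R W U = ecard C"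
    using lin_dim_basis[OF assms(3)] by blast
  have *: "lin_indep B" "lin_indep C" "lin_span R W B = U" "lin_span R W C = U"
    "B \<subseteq> carrier W" "C \<subseteq> carrier W"
    using assms(1) C(1) is_basis_iff[OF assms(3)] by (auto simp: lin_indep_def)
  have "finite C \<and> card C \<le> card B"
    using * assms(2) lin_span_superset[of C] by (intro lin_indep_card_le) auto
  moreover have "card B \<le> card C" if "finite C"
    using * that assms(2) lin_span_superset[of B] by (intro lin_indep_card_le_finite) auto
  ultimately show ?thesis using C(2) by (simp add: ecard_def)
qed

text \<open>Bounding finite independent subsets suffices, since an infinite basis would contain
  finite independent subsets of every size.\<close>

lemma lin_dim_le:
  assumes "submodule U R W" "\<And>I. lin_indep I \<Longrightarrow> I \<subseteq> U \<Longrightarrow> finite I \<Longrightarrow> card I \<le> k"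
  shows "lin_dim R W U \<le> enat k"
proof -
  obtain B where B: "is_basis R W U B" "lin_dim R W U = ecard B"
    using lin_dim_basis[OF assms(1)] by blast
  have *: "lin_indep B" "B \<subseteq> U"
    using is_basis_iff[OF assms(1)] B lin_span_superset[of B] by auto
  have "finite B"
  proof (rule ccontr)
    assume "infinite B"
    then obtain J where "J \<subseteq> B" "finite J" "card J = Suc k"
      using infinite_arbitrarily_large by metis
    with assms(2)[of J] * lin_indep_mono show False by fastforce
  qed
  thus ?thesis using B(2) assms(2) * by (simp add: ecard_def)
qed

lemma lin_dim_enatD:
  assumes "submodule U R W" "lin_dim R W U = enat k"
  shows "\<exists>B. finite B \<and> card B = k \<and> lin_indep B \<and> lin_span R W B = U"
  using lin_dim_basis[OF assms(1)] assms(2) is_basis_iff[OF assms(1)]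
  by (auto simp: ecard_def split: if_splits)

section \<open>Projective points and lines, and preimages of submodules\<close>

lemma PG_pointD:
  assumes "x \<in> points (PG R W)"
  shows "\<exists>w. lin_indep {w} \<and> x = lin_span R W {w}"
proof -
  have "submodule x R W" "lin_dim R W x = enat 1"
    using assms by (auto simp: PG_def one_enat_def)
  thus ?thesis using lin_dim_enatD by (metis card_1_singletonE)
qed

text \<open>Distinct points \<open>x\<close> and \<open>y\<close> have independent representatives
  \<open>v\<close> and \<open>w\<close>, which span the two-dimensional \<open>L\<close>; so
  \<open>U\<close> contains all of \<open>L\<close>.\<close>

lemma PG_line_subset:
  assumes l: "l \<in> lines (PG R W)" and U: "submodule U R W"
    and x: "x \<in> l" "x \<subseteq> U" and y: "y \<in> l" "y \<subseteq> U" and "x \<noteq> y" and z: "z \<in> l"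
  shows "z \<subseteq> U"
proof -
  obtain L where L: "submodule L R W" "lin_dim R W L = enat 2"
      and l: "l = {x. submodule x R W \<and> lin_dim R W x = 1 \<and> x \<subseteq> L}"
    using l by (auto simp: PG_def numeral_eq_enat)
  obtain B where B: "finite B" "card B = 2" "lin_indep B" "lin_span R W B = L"
    using lin_dim_enatD[OF L] by blast
  have "x \<in> points (PG R W)" "y \<in> points (PG R W)" using x y by (auto simp: l PG_def)
  then obtain v w where v: "lin_indep {v}" "x = lin_span R W {v}"
    and w: "lin_indep {w}" "y = lin_span R W {w}" using PG_pointD by metis
  have c: "v \<in> carrier W" "w \<in> carrier W" using v w by (auto simp: lin_indep_def)
  have vw: "v \<notin> lin_span R W {w}"
  proof
    assume vw: "v \<in> lin_span R W {w}"
    moreover have "v \<notin> lin_span R W {}" using v by (auto simp: lin_indep_def)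
    ultimately have "w \<in> lin_span R W {v}" using lin_span_exchange[of w "{}" v] c by simp
    hence "x = y" using vw v w c lin_span_subset_lin_span[of "{v}" "{w}"]
        lin_span_subset_lin_span[of "{w}" "{v}"] by auto
    with \<open>x \<noteq> y\<close> show False by simp
  qed
  hence ind: "lin_indep {v, w}" using lin_indep_insert[OF w(1) c(1)] by simp
  have ne: "v \<noteq> w" using vw lin_span_superset[of "{w}"] by blast
  have vwL: "v \<in> L" "w \<in> L" "v \<in> U" "w \<in> U"
    using x y v(2) w(2) lin_span_superset[of "{v}"] lin_span_superset[of "{w}"]
    by (auto simp: l)
  \<comment> \<open>A vector of \<open>L\<close> outside this span would give three independent
    vectors in dimension 2.\<close>
  have "L \<subseteq> lin_span R W {v, w}"
  proof
    fix u assume u: "u \<in> L"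
    show "u \<in> lin_span R W {v, w}"
    proof (rule ccontr)
      assume n: "u \<notin> lin_span R W {v, w}"
      hence "lin_indep {u, v, w}"
        using lin_indep_insert[OF ind _ n] u submodule_carrier[OF L(1)] by auto
      hence "card {u, v, w} \<le> card B"
        using B u vwL by (intro lin_indep_card_le_finite) (auto simp: lin_indep_def)
      moreover have "u \<noteq> v" "u \<noteq> w" using n lin_span_superset[of "{v, w}"] by blast+
      ultimately show False using ne B by simp
    qed
  qed
  also have "\<dots> \<subseteq> U" using vwL by (intro lin_span_minimal U) auto
  finally show ?thesis using z by (auto simp: l)
qed

text \<open>Injectivity keeps the images of two points of a line distinct, so two image points
  inside \<open>U\<close> force the whole image line into \<open>U\<close>.\<close>

lemma geom_subspace_vimage:
  assumes e: "projective_embedding \<Gamma> R W e" and U: "submodule U R W"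
    and lp: "\<And>l. l \<in> lines \<Gamma> \<Longrightarrow> l \<subseteq> points \<Gamma>"
  shows "geom_subspace \<Gamma> {x \<in> points \<Gamma>. e x \<subseteq> U}"
  unfolding geom_subspace_def
proof (intro conjI ballI impI subsetI)
  fix l z assume l: "l \<in> lines \<Gamma>" and z: "z \<in> l"
    and "\<exists>x\<in>l \<inter> {x \<in> points \<Gamma>. e x \<subseteq> U}. \<exists>y\<in>l \<inter> {x \<in> points \<Gamma>. e x \<subseteq> U}. x \<noteq> y"
  then obtain x y where xy: "x \<in> l" "y \<in> l" "e x \<subseteq> U" "e y \<subseteq> U" "x \<noteq> y"
    "x \<in> points \<Gamma>" "y \<in> points \<Gamma>" by blast
  have "e ` l \<in> lines (PG R W)" "e x \<noteq> e y"
    using e l xy by (auto simp: projective_embedding_def inj_on_def)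
  hence "e z \<subseteq> U" using PG_line_subset[of "e ` l" U "e x" "e y" "e z"] U xy z by auto
  thus "z \<in> {x \<in> points \<Gamma>. e x \<subseteq> U}" using lp l z by auto
qed auto

text \<open>Finitely many independent vectors lie in the span of the images of a finite set
  \<open>S\<close> of points. As \<open>S\<close> depends on at most \<open>k\<close> points, they
  lie in the span of at most \<open>k\<close> vectors, and exchange bounds their number.\<close>

lemma lin_dim_embedding_le:
  assumes e: "projective_embedding \<Gamma> R W e"
    and lp: "\<And>l. l \<in> lines \<Gamma> \<Longrightarrow> l \<subseteq> points \<Gamma>"
    and gen: "\<And>S. finite S \<Longrightarrow> S \<subseteq> points \<Gamma> \<Longrightarrow> \<exists>G\<subseteq>points \<Gamma>. finite G \<and> card G \<le> k \<and>
       (\<forall>Y. geom_subspace \<Gamma> Y \<and> G \<subseteq> Y \<longrightarrow> S \<subseteq> Y)"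
  shows "lin_dim R W (carrier W) \<le> enat k"
proof (rule lin_dim_le[OF submodule_whole])
  have eP: "e ` points \<Gamma> \<subseteq> points (PG R W)" and
    sp: "lin_span R W (\<Union>(e ` points \<Gamma>)) = carrier W"
    using e by (auto simp: projective_embedding_def)
  have eW: "\<Union>(e ` points \<Gamma>) \<subseteq> carrier W"
    using sp lin_span_superset[of "\<Union>(e ` points \<Gamma>)"] by blast
  fix I assume I: "lin_indep I" "I \<subseteq> carrier W" "finite I"
  have "\<exists>F\<subseteq>\<Union>(e ` points \<Gamma>). finite F \<and> b \<in> lin_span R W F" if "b \<in> I" for b
    using lin_span_finitary[OF eW] sp that I by blast
  then obtain F where F: "\<And>b. b \<in> I \<Longrightarrow> F b \<subseteq> \<Union>(e ` points \<Gamma>)" "\<And>b. b \<in> I \<Longrightarrow> finite (F b)"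
    "\<And>b. b \<in> I \<Longrightarrow> b \<in> lin_span R W (F b)" by metis
  have "finite (\<Union>(F ` I))" "\<Union>(F ` I) \<subseteq> \<Union>(e ` points \<Gamma>)" using F I by auto
  then obtain S where S: "S \<subseteq> points \<Gamma>" "finite S" "\<Union>(F ` I) \<subseteq> \<Union>(e ` S)"
    by (metis finite_subset_Union finite_subset_image)
  obtain G where G: "G \<subseteq> points \<Gamma>" "finite G" "card G \<le> k"
    "\<And>Y. geom_subspace \<Gamma> Y \<Longrightarrow> G \<subseteq> Y \<Longrightarrow> S \<subseteq> Y" using gen[OF S(2,1)] by blast
  have "\<forall>g\<in>G. \<exists>w. lin_indep {w} \<and> e g = lin_span R W {w}" using G eP PG_pointD by blast
  then obtain w where w: "\<And>g. g \<in> G \<Longrightarrow> lin_indep {w g}" "\<And>g. g \<in> G \<Longrightarrow> e g = lin_span R W {w g}"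
    by metis
  have wc: "w ` G \<subseteq> carrier W" using w by (auto simp: lin_indep_def)
  \<comment> \<open>One representative for each point of \<open>G\<close>. The preimage of
    \<open>?U\<close> is a subspace of the geometry that contains \<open>G\<close>, hence
    \<open>S\<close>.\<close>
  let ?U = "lin_span R W (w ` G)"
  have U: "submodule ?U R W" by (rule submodule_lin_span[OF wc])
  have "e g \<subseteq> ?U" if "g \<in> G" for g
    using w(2)[OF that] lin_span_mono[of "{w g}" "w ` G"] that by auto
  hence "G \<subseteq> {x \<in> points \<Gamma>. e x \<subseteq> ?U}" using G by auto
  hence "S \<subseteq> {x \<in> points \<Gamma>. e x \<subseteq> ?U}" using G(4) geom_subspace_vimage[OF e U lp] by blast
  hence FU: "\<Union>(F ` I) \<subseteq> ?U" using S by blast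
  have "I \<subseteq> ?U"
  proof
    fix b assume b: "b \<in> I"
    hence "F b \<subseteq> ?U" using FU by blast
    hence "lin_span R W (F b) \<subseteq> ?U" by (rule lin_span_minimal[OF U])
    thus "b \<in> ?U" using F b by blast
  qed
  hence "card I \<le> card (w ` G)" using G wc I by (intro lin_indep_card_le_finite) auto
  also have "\<dots> \<le> k" using G card_image_le le_trans by blast
  finally show "card I \<le> k" .
qed

end

section \<open>Flags as pairs of a vector and a linear form\<close>

lemma geom_subspaceD:
  assumes "geom_subspace \<Gamma> Y" "l \<in> lines \<Gamma>" "x \<in> l" "y \<in> l" "x \<in> Y" "y \<in> Y" "x \<noteq> y" "z \<in> l"
  shows "z \<in> Y"
  using assms unfolding geom_subspace_def by blast

context finite_dimensional_vector_space
begin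

section \<open>Linear forms and their kernels\<close>

definition lin_form :: "('b \<Rightarrow> 'a) \<Rightarrow> bool" where
  "lin_form f \<longleftrightarrow> (\<forall>x y. f (x + y) = f x + f y) \<and> (\<forall>c x. f (scale c x) = c * f x)"

lemma lin_form_add: "lin_form f \<Longrightarrow> f (x + y) = f x + f y"
  and lin_form_scale: "lin_form f \<Longrightarrow> f (scale c x) = c * f x"
  by (auto simp: lin_form_def)

lemma lin_form_zero: "lin_form f \<Longrightarrow> f 0 = 0"
  using lin_form_scale[of f 0 0] by simp

lemma lin_form_diff: "lin_form f \<Longrightarrow> f (x - y) = f x - f y"
  using lin_form_add[of f "x - y" y] by simp

lemma lin_form_sum: "lin_form f \<Longrightarrow> f (\<Sum>i\<in>I. g i) = (\<Sum>i\<in>I. f (g i))"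
  by (induction I rule: infinite_finite_induct) (auto simp: lin_form_zero lin_form_add)

lemma lin_form_lincomb: "lin_form f \<Longrightarrow> lin_form g \<Longrightarrow> lin_form (\<lambda>x. a * f x + b * g x)"
  by (auto simp: lin_form_def algebra_simps)

lemma subspace_kernel: "lin_form f \<Longrightarrow> subspace {x. f x = 0}"
  by (auto simp: subspace_def lin_form_zero lin_form_add lin_form_scale)

lemma dim_kernel_in_subspace:
  assumes f: "lin_form f" and U: "subspace U" and x: "x \<in> U" "f x \<noteq> 0"
  shows "dim U = dim (U \<inter> {y. f y = 0}) + 1"
proof -
  let ?K = "U \<inter> {y. f y = 0}"
  have sK: "subspace ?K" using U subspace_kernel[OF f] by (rule subspace_inter)
  have "U \<subseteq> span (insert x ?K)"
  proof
    fix y assume y: "y \<in> U"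
    have "y - scale (f y / f x) x \<in> ?K"
      using y x f U by (auto simp: lin_form_diff lin_form_scale intro: subspace_diff subspace_scale)
    thus "y \<in> span (insert x ?K)" by (subst span_breakdown_eq) (auto intro: span_base)
  qed
  moreover have "span (insert x ?K) \<subseteq> U" using U x by (intro span_minimal) auto
  ultimately have "dim U = dim (insert x ?K)" by (metis dim_span subset_antisym)
  moreover have "x \<notin> span ?K" using span_minimal[OF subset_refl sK] x by blast
  ultimately show ?thesis by (simp add: dim_insert)
qed

lemma dim_kernel: "lin_form f \<Longrightarrow> f x \<noteq> 0 \<Longrightarrow> card Basis = dim {y. f y = 0} + 1"
  using dim_kernel_in_subspace[of f UNIV x] by (simp add: dim_UNIV)

text \<open>Fix \<open>x\<close> outside \<open>H\<close>. The form sends \<open>y\<close> to the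
  unique scalar \<open>c\<close> for which \<open>y - scale c x\<close> lies in
  \<open>H\<close>.\<close>

lemma hyperplane_is_kernel:
  assumes H: "subspace H" "card Basis = dim H + 1"
  shows "\<exists>f x. lin_form f \<and> f x \<noteq> 0 \<and> H = {y. f y = 0}"
proof -
  have "H \<noteq> UNIV" using H by (auto simp: dim_UNIV)
  then obtain x where x: "x \<notin> H" by blast
  have "dim (insert x H) = card Basis" using x H(2) span_minimal[OF subset_refl H(1)] by (auto simp: dim_insert)
  hence UN: "span (insert x H) = UNIV"
    using dim_eq_full[of "insert x H"] by (simp add: dimension_def)
  have "\<exists>c. y - scale c x \<in> H" for y
    using UN span_breakdown_eq[of y x H] span_minimal[OF subset_refl H(1)] by blast
  then obtain f where f: "\<And>y. y - scale (f y) x \<in> H" by metis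
  \<comment> \<open>This uniqueness makes the chosen coefficients additive and homogeneous.\<close>
  have uniq: "f y = c" if "y - scale c x \<in> H" for y c
  proof (rule ccontr)
    assume "f y \<noteq> c"
    have "scale (f y - c) x \<in> H"
      using subspace_diff[OF H(1) that f[of y]] by (simp add: scale_left_diff_distrib)
    hence "scale (inverse (f y - c)) (scale (f y - c) x) \<in> H" by (rule subspace_scale[OF H(1)])
    with \<open>f y \<noteq> c\<close> x show False by simp
  qed
  have "lin_form f"
    unfolding lin_form_def
  proof (intro conjI allI uniq)
    fix y z :: 'b and c :: 'a
    have "(y - scale (f y) x) + (z - scale (f z) x) \<in> H"
      using subspace_add[OF H(1) f f] .
    thus "y + z - scale (f y + f z) x \<in> H" by (simp add: algebra_simps scale_left_distrib)
    have "scale c (y - scale (f y) x) \<in> H" using subspace_scale[OF H(1) f] .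
    thus "scale c y - scale (c * f y) x \<in> H" by (simp add: scale_right_diff_distrib)
  qed
  moreover have "f y = 0 \<longleftrightarrow> y \<in> H" for y using f[of y] uniq[of y 0] by auto
  ultimately show ?thesis using x by (intro exI[of _ f] exI[of _ x]) auto
qed

lemma dim_1_is_span:
  assumes "subspace p" "dim p = 1"
  shows "\<exists>v. v \<noteq> 0 \<and> p = span {v}"
proof -
  obtain B where B: "B \<subseteq> p" "independent B" "p \<subseteq> span B" "card B = dim p"
    by (rule basis_exists)
  then obtain v where v: "B = {v}" using assms(2) by (auto simp: card_1_singleton_iff)
  have "v \<noteq> 0" using B(2) v dependent_zero by blast
  moreover have "p = span {v}" using B v assms(1) span_minimal[of "{v}" p] by auto
  ultimately show ?thesis by blast
qed

lemma span_singleton_nonzero_mem: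
  assumes "w \<in> span {v}" "w \<noteq> 0"
  shows "span {w} = span {v}"
proof -
  obtain c where c: "w = scale c v" using assms(1) by (auto simp: span_singleton)
  hence "scale (inverse c) w = v" using assms(2) by auto
  hence "v \<in> span {w}" by (auto simp: span_singleton)
  with assms(1) show ?thesis by (simp add: span_eq)
qed

text \<open>Multiplying \<open>v\<close> or \<open>f\<close> by a nonzero scalar does not change the
  flag. For a linear form \<open>f\<close> it is a point of the geometry only if \<open>v\<close>
  and \<open>f\<close> are nonzero and \<open>f v = 0\<close>.\<close>

definition flag :: "'b \<Rightarrow> ('b \<Rightarrow> 'a) \<Rightarrow> 'b set \<times> 'b set" where
  "flag v f = (span {v}, {x. f x = 0})"

lemma points_flag_geometry:
  assumes "card Basis = n + 1"
  shows "points (flag_geometry n) = {flag v f | v f. v \<noteq> 0 \<and> lin_form f \<and> (\<exists>x. f x \<noteq> 0) \<and> f v = 0}"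
    (is "?P = ?Q")
proof (intro equalityI subsetI)
  fix z assume "z \<in> ?P"
  then obtain p H where z: "z = (p, H)" "subspace p" "dim p = 1" "subspace H" "dim H = n" "p \<subseteq> H"
    by (auto simp: flag_geometry_def)
  obtain v where v: "v \<noteq> 0" "p = span {v}" using dim_1_is_span z by blast
  obtain f x where f: "lin_form f" "f x \<noteq> 0" "H = {y. f y = 0}"
    using hyperplane_is_kernel z assms by metis
  have "v \<in> H" using v z span_superset by blast
  thus "z \<in> ?Q" using z v f unfolding flag_def by blast
next
  fix z assume "z \<in> ?Q"
  then obtain v f x where z: "z = flag v f" "v \<noteq> 0" "lin_form f" "f x \<noteq> 0" "f v = 0" by blast
  have "dim {y. f y = 0} = n" using dim_kernel z assms by fastforce
  moreover have "span {v} \<subseteq> {y. f y = 0}"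
    using z subspace_kernel by (intro span_minimal) auto
  ultimately show "z \<in> ?P"
    using z subspace_kernel by (auto simp: flag_geometry_def flag_def)
qed

lemma pencil_line:
  assumes "dim S = n - 1" "subspace S" "p \<subseteq> S" "dim p = 1" "subspace p"
  shows "{(p, Z) | Z. subspace Z \<and> dim Z = n \<and> S \<subseteq> Z} \<in> lines (flag_geometry n)"
  unfolding flag_geometry_def geometry.simps using assms by blast

lemma range_line:
  assumes "dim L = 2" "dim H = n" "L \<subseteq> H" "subspace H" "subspace L"
  shows "{(x, H) | x. subspace x \<and> dim x = 1 \<and> x \<subseteq> L} \<in> lines (flag_geometry n)"
  unfolding flag_geometry_def geometry.simps using assms by blast

lemma lines_subset_points:
  assumes "l \<in> lines (flag_geometry n)"
  shows "l \<subseteq> points (flag_geometry n)"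
  using assms by (auto simp: flag_geometry_def)

text \<open>Degenerate pairs are admitted so that the relation becomes bilinear.\<close>

definition flag_rel :: "('b set \<times> 'b set) set \<Rightarrow> 'b \<Rightarrow> ('b \<Rightarrow> 'a) \<Rightarrow> bool" where
  "flag_rel Y v f \<longleftrightarrow> lin_form f \<and> f v = 0 \<and> (v = 0 \<or> (\<forall>x. f x = 0) \<or> flag v f \<in> Y)"

lemma flag_rel_zero: "lin_form f \<Longrightarrow> flag_rel Y 0 f"
  by (simp add: flag_rel_def lin_form_zero)

text \<open>If \<open>v\<close> and \<open>w\<close> are independent, the three flags lie on the
  line given by \<open>span {v, w}\<close> and the kernel of \<open>f\<close>; otherwise a nonzero
  combination spans the same point as \<open>v\<close> or \<open>w\<close>.\<close>

lemma flag_rel_vector_lincomb: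
  assumes Y: "geom_subspace (flag_geometry n) Y" and n: "card Basis = n + 1"
    and v: "flag_rel Y v f" and w: "flag_rel Y w f"
  shows "flag_rel Y (scale a v + scale b w) f"
proof -
  let ?u = "scale a v + scale b w"
  have f: "lin_form f" "f v = 0" "f w = 0" using v w by (auto simp: flag_rel_def)
  have fu: "f ?u = 0" using f by (simp add: lin_form_add lin_form_scale)
  show ?thesis
  proof (cases "?u = 0 \<or> (\<forall>x. f x = 0)")
    case True
    thus ?thesis using f fu by (auto simp: flag_rel_def)
  next
    case False
    then obtain x where x: "f x \<noteq> 0" and u0: "?u \<noteq> 0" by blast
    have vw: "v = 0 \<or> flag v f \<in> Y" "w = 0 \<or> flag w f \<in> Y" using v w x by (auto simp: flag_rel_def)
    have "flag ?u f \<in> Y"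
    proof (cases "v \<in> span {w} \<or> w \<in> span {v}")
      case True
      \<comment> \<open>In the dependent case one of the two vectors, \<open>z\<close>, spans
        both.\<close>
      then obtain z where z: "z = v \<or> z = w" "v \<in> span {z}" "w \<in> span {z}"
        using span_base by blast
      hence "?u \<in> span {z}" by (intro span_add span_scale)
      hence "span {?u} = span {z}" using u0 by (rule span_singleton_nonzero_mem)
      moreover have "z \<noteq> 0" using u0 z by (auto simp: span_singleton)
      ultimately show ?thesis using vw z(1) by (auto simp: flag_def)
    next
      case False
      let ?L = "span {v, w}" and ?H = "{y. f y = 0}"
      have v0: "v \<noteq> 0" "w \<noteq> 0" using False span_zero by blast+
      have "dim ?L = 2" using False v0 by (simp add: dim_insert)
      moreover have "dim ?H = n" using dim_kernel[of f x] f x n by simp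
      moreover have "?L \<subseteq> ?H" using f subspace_kernel by (intro span_minimal) auto
      ultimately have l: "{(x, ?H) | x. subspace x \<and> dim x = 1 \<and> x \<subseteq> ?L} \<in> lines (flag_geometry n)"
        (is "?l \<in> _") by (rule range_line[OF _ _ _ subspace_kernel[OF f(1)] subspace_span])
      have in_l: "flag z f \<in> ?l" if "z \<noteq> 0" "z \<in> ?L" for z
        using that span_minimal[of "{z}" ?L] by (auto simp: flag_def)
      show ?thesis
      proof (rule geom_subspaceD[OF Y l])
        show "flag v f \<in> ?l" "flag w f \<in> ?l" using in_l v0 by (auto intro: span_base)
        show "flag v f \<in> Y" "flag w f \<in> Y" using v0 vw by auto
        show "flag v f \<noteq> flag w f" using False span_base[of v "{v}"] by (auto simp: flag_def)
        show "flag ?u f \<in> ?l" by (intro in_l u0 span_add span_scale span_base) auto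
      qed
    qed
    thus ?thesis using f fu by (auto simp: flag_rel_def)
  qed
qed

text \<open>Dual to the combination of vectors: for forms with distinct kernels the line is the
  pencil of hyperplanes through the intersection of the kernels.\<close>

lemma flag_rel_form_lincomb:
  assumes Y: "geom_subspace (flag_geometry n) Y" and n: "card Basis = n + 1"
    and f: "flag_rel Y v f" and g: "flag_rel Y v g"
  shows "flag_rel Y v (\<lambda>x. a * f x + b * g x)"
proof -
  let ?h = "\<lambda>x. a * f x + b * g x"
  have fg: "lin_form f" "lin_form g" "f v = 0" "g v = 0" using f g by (auto simp: flag_rel_def)
  have h: "lin_form ?h" "?h v = 0" using fg by (auto intro: lin_form_lincomb)
  show ?thesis
  proof (cases "v = 0 \<or> (\<forall>x. ?h x = 0)")
    case True
    thus ?thesis using h by (auto simp: flag_rel_def)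
  next
    case False
    then obtain x where x: "?h x \<noteq> 0" and v0: "v \<noteq> 0" by blast
    have dk: "dim {y. k y = 0} = n" if "lin_form k" "k z \<noteq> 0" for k z
      using dim_kernel[OF that] n by simp
    have "flag v ?h \<in> Y"
    proof (cases "(\<forall>y. f y = 0) \<or> (\<forall>y. g y = 0) \<or> {y. f y = 0} = {y. g y = 0}")
      case True
      \<comment> \<open>A nonzero one of the two forms has its kernel inside that of the
        combination; equal dimensions then make the two kernels equal.\<close>
      have "\<exists>k. (k = f \<or> k = g) \<and> (\<exists>z. k z \<noteq> 0) \<and> (\<forall>y. k y = 0 \<longrightarrow> ?h y = 0)"
      proof (cases "\<forall>y. f y = 0")
        case True
        thus ?thesis using x by (intro exI[of _ g]) auto
      next
        case False
        moreover have "g y = 0" if "f y = 0" for y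
          using \<open>(\<forall>y. f y = 0) \<or> (\<forall>y. g y = 0) \<or> {y. f y = 0} = {y. g y = 0}\<close> False that by auto
        ultimately show ?thesis by (intro exI[of _ f]) auto
      qed
      then obtain k z where k: "k = f \<or> k = g" "\<And>y. k y = 0 \<Longrightarrow> ?h y = 0" and z: "k z \<noteq> 0"
        by blast
      have "{y. k y = 0} = {y. ?h y = 0}"
        using k(2) dk[of k z] z dk[OF h(1) x] fg h k(1)
        by (intro subspace_dim_equal subspace_kernel) auto
      moreover have "flag v k \<in> Y" using k(1) f g v0 z by (auto simp: flag_rel_def)
      ultimately show ?thesis by (simp add: flag_def)
    next
      case False
      then obtain z1 z2 where z1: "f z1 \<noteq> 0" and z2: "g z2 \<noteq> 0" by blast
      let ?S = "{y. f y = 0} \<inter> {y. g y = 0}"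
      have dfg: "dim {y. f y = 0} = n" "dim {y. g y = 0} = n" using dk fg z1 z2 by auto
      \<comment> \<open>Distinct kernels of the same dimension \<open>n\<close> are not nested, so
        \<open>g\<close> is nonzero somewhere on the kernel of \<open>f\<close> and the intersection
        has dimension \<open>n - 1\<close>.\<close>
      have "\<not> {y. f y = 0} \<subseteq> {y. g y = 0}"
        using False dfg fg subspace_dim_equal[OF subspace_kernel subspace_kernel, of f g] by auto
      then obtain x0 where "f x0 = 0" "g x0 \<noteq> 0" by blast
      hence "dim ?S = n - 1"
        using dim_kernel_in_subspace[OF fg(2) subspace_kernel[OF fg(1)], of x0] dfg by simp
      moreover have sS: "subspace ?S" using fg by (intro subspace_inter subspace_kernel)
      moreover have "span {v} \<subseteq> ?S" using sS fg by (intro span_minimal) auto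
      moreover have "dim (span {v}) = 1" using v0 by simp
      moreover have "subspace (span {v})" by (rule subspace_span)
      ultimately have l: "{(span {v}, Z) | Z. subspace Z \<and> dim Z = n \<and> ?S \<subseteq> Z} \<in> lines (flag_geometry n)"
        (is "?l \<in> _") by (rule pencil_line)
      show ?thesis
      proof (rule geom_subspaceD[OF Y l])
        show "flag v f \<in> ?l" "flag v g \<in> ?l"
          using dfg subspace_kernel[OF fg(1)] subspace_kernel[OF fg(2)] by (auto simp: flag_def)
        show "flag v f \<in> Y" "flag v g \<in> Y" using f g v0 z1 z2 by (auto simp: flag_rel_def)
        show "flag v f \<noteq> flag v g" using False by (auto simp: flag_def)
        show "flag v ?h \<in> ?l"
          using dk[OF h(1) x] subspace_kernel[OF h(1)] by (auto simp: flag_def)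
      qed
    qed
    thus ?thesis using h by (auto simp: flag_rel_def)
  qed
qed

lemma flag_rel_vector_sum:
  assumes "geom_subspace (flag_geometry n) Y" "card Basis = n + 1" "lin_form f"
    and "\<And>i. i \<in> I \<Longrightarrow> flag_rel Y (g i) f"
  shows "flag_rel Y (\<Sum>i\<in>I. g i) f"
  using assms(4)
proof (induction I rule: infinite_finite_induct)
  case (insert i I)
  thus ?case using flag_rel_vector_lincomb[OF assms(1,2), of "g i" f "sum g I" 1 1] by simp
qed (use assms(3) in \<open>auto simp: flag_rel_zero\<close>)

lemma flag_rel_form_sum:
  assumes "geom_subspace (flag_geometry n) Y" "card Basis = n + 1"
    and "\<And>i. i \<in> I \<Longrightarrow> flag_rel Y v (g i)"
  shows "flag_rel Y v (\<lambda>x. \<Sum>i\<in>I. g i x)"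
  using assms(3)
proof (induction I rule: infinite_finite_induct)
  case (insert i I)
  thus ?case
    using flag_rel_form_lincomb[OF assms(1,2), of v "g i" "\<lambda>x. \<Sum>i\<in>I. g i x" 1 1] by simp
qed (auto simp: flag_rel_def lin_form_def)

text \<open>The dual basis; the vector is the second argument so that \<open>coord b\<close> is
  itself a form.\<close>

definition coord :: "'b \<Rightarrow> 'b \<Rightarrow> 'a" where
  "coord b x = representation Basis x b"

lemma lin_form_coord: "lin_form (coord b)"
  by (simp add: lin_form_def coord_def representation_add representation_scale
      independent_Basis span_Basis)

lemma coord_basis: "b \<in> Basis \<Longrightarrow> c \<in> Basis \<Longrightarrow> coord b c = (if b = c then 1 else 0)"
  by (auto simp: coord_def representation_basis independent_Basis)

lemma sum_coord: "(\<Sum>b\<in>Basis. scale (coord b x) b) = x"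
  unfolding coord_def
  by (rule sum_representation_eq) (auto simp: independent_Basis span_Basis finite_Basis)

lemma lin_form_expand:
  assumes "lin_form f"
  shows "f x = (\<Sum>b\<in>Basis. f b * coord b x)"
proof -
  have "f x = f (\<Sum>b\<in>Basis. scale (coord b x) b)" by (simp add: sum_coord)
  also have "\<dots> = (\<Sum>b\<in>Basis. f b * coord b x)"
    using assms by (simp add: lin_form_sum lin_form_scale mult.commute)
  finally show ?thesis .
qed

end

section \<open>The generating rank\<close>

lemma generating_rank_eq_infinity:
  assumes "\<And>S. generates \<Gamma> S \<Longrightarrow> infinite S"
  shows "generating_rank \<Gamma> = \<infinity>"
proof -
  have "\<infinity> \<le> ecard S" if "generates \<Gamma> S" for S
    using assms[OF that] by (simp add: ecard_def)
  hence "\<infinity> \<le> generating_rank \<Gamma>"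
    unfolding generating_rank_def by (intro INF_greatest) auto
  thus ?thesis by simp
qed

context finite_dimensional_vector_space
begin

text \<open>Some coordinate of a nonzero vector is nonzero and can be scaled to 1. The other
  coordinates are then the ratios on which the later arguments work.\<close>

lemma points_flag_geometry_normalised:
  assumes "z \<in> points (flag_geometry n)" "card Basis = n + 1"
  shows "\<exists>v f i. z = flag v f \<and> i \<in> Basis \<and> coord i v = 1 \<and> lin_form f \<and> (\<exists>x. f x \<noteq> 0) \<and> f v = 0"
proof -
  obtain v f where z: "z = flag v f" "v \<noteq> 0" "lin_form f" "\<exists>x. f x \<noteq> 0" "f v = 0"
    using assms points_flag_geometry[of n] by auto
  have "\<exists>i\<in>Basis. coord i v \<noteq> 0"
  proof (rule ccontr)
    assume "\<not> ?thesis"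
    hence "(\<Sum>b\<in>Basis. scale (coord b v) b) = 0" by (intro sum.neutral) auto
    with z show False by (simp add: sum_coord)
  qed
  then obtain i where i: "i \<in> Basis" "coord i v \<noteq> 0" by blast
  let ?w = "scale (inverse (coord i v)) v"
  have "?w \<in> span {v}" "?w \<noteq> 0" using z i by (auto intro: span_scale span_base)
  hence "span {?w} = span {v}" by (rule span_singleton_nonzero_mem)
  hence "z = flag ?w f" using z by (simp add: flag_def)
  moreover have "coord i ?w = 1" "f ?w = 0"
    using i z lin_form_scale[OF lin_form_coord, of i] by (auto simp: lin_form_scale)
  ultimately show ?thesis using i z by blast
qed

lemma flag_in_points:
  assumes "card Basis = n + 1" "lin_form f" "v \<noteq> 0" "f x \<noteq> 0" "f v = 0"
  shows "flag v f \<in> points (flag_geometry n)"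
  using assms points_flag_geometry[OF assms(1)] by blast

section \<open>The coordinatewise semilinear map and separated flags\<close>

definition coord_semilinear :: "('a \<Rightarrow> 'a) \<Rightarrow> 'b \<Rightarrow> 'b" where
  "coord_semilinear \<phi> v = (\<Sum>b\<in>Basis. scale (\<phi> (coord b v)) b)"

text \<open>Stability is required as an inclusion, a condition that passes to intersections and to
  spans of unions.\<close>

definition separated_flags :: "nat \<Rightarrow> ('a \<Rightarrow> 'a) \<Rightarrow> ('b set \<times> 'b set) set" where
  "separated_flags n \<phi> = {(p, H) \<in> points (flag_geometry n).
     \<exists>U. subspace U \<and> coord_semilinear \<phi> ` U \<subseteq> U \<and> p \<subseteq> U \<and> U \<subseteq> H}"

lemma coord_semilinear_add:
  assumes "\<And>a b. \<phi> (a + b) = \<phi> a + \<phi> b"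
  shows "coord_semilinear \<phi> (v + w) = coord_semilinear \<phi> v + coord_semilinear \<phi> w"
  using lin_form_add[OF lin_form_coord]
  by (simp add: coord_semilinear_def assms scale_left_distrib sum.distrib)

lemma coord_semilinear_scale:
  assumes "\<And>a b. \<phi> (a * b) = \<phi> a * \<phi> b"
  shows "coord_semilinear \<phi> (scale c v) = scale (\<phi> c) (coord_semilinear \<phi> v)"
  using lin_form_scale[OF lin_form_coord]
  by (simp add: coord_semilinear_def assms scale_sum_right)

lemma coord_semilinear_fixed:
  assumes "\<And>b. b \<in> Basis \<Longrightarrow> \<phi> (coord b v) = coord b v"
  shows "coord_semilinear \<phi> v = v"
  using assms by (simp add: coord_semilinear_def sum_coord cong: sum.cong)

lemma coord_semilinear_zero:
  assumes "\<And>a b. \<phi> (a + b) = \<phi> a + \<phi> b"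
  shows "coord_semilinear \<phi> 0 = 0"
  using coord_semilinear_add[OF assms, of 0 0] by simp

lemma coord_semilinear_span:
  assumes add: "\<And>a b. \<phi> (a + b) = \<phi> a + \<phi> b" and mult: "\<And>a b. \<phi> (a * b) = \<phi> a * \<phi> b"
    and A: "coord_semilinear \<phi> ` A \<subseteq> span A"
  shows "coord_semilinear \<phi> ` span A \<subseteq> span A"
proof -
  have "subspace {x. coord_semilinear \<phi> x \<in> span A}"
    by (auto simp: subspace_def coord_semilinear_zero[OF add] coord_semilinear_add[OF add]
        coord_semilinear_scale[OF mult] intro: span_zero span_add span_scale)
  moreover have "A \<subseteq> {x. coord_semilinear \<phi> x \<in> span A}" using A by auto
  ultimately show ?thesis using span_minimal by blast
qed

text \<open>A single stable subspace separates all flags of the line: the intersection of the two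
  given ones on a pencil, and the span of their union on a line with fixed hyperplane.\<close>

lemma geom_subspace_separated_flags:
  assumes n: "n \<ge> 2"
    and add: "\<And>a b. \<phi> (a + b) = \<phi> a + \<phi> b" and mult: "\<And>a b. \<phi> (a * b) = \<phi> a * \<phi> b"
  shows "geom_subspace (flag_geometry n) (separated_flags n \<phi>)"
  unfolding geom_subspace_def
proof (intro conjI ballI impI)
  show "separated_flags n \<phi> \<subseteq> points (flag_geometry n)" by (auto simp: separated_flags_def)
  fix l assume l: "l \<in> lines (flag_geometry n)"
    and "\<exists>x\<in>l \<inter> separated_flags n \<phi>. \<exists>y\<in>l \<inter> separated_flags n \<phi>. x \<noteq> y"
  then obtain x y where xy: "x \<in> l" "y \<in> l" "x \<noteq> y" "x \<in> separated_flags n \<phi>"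
    "y \<in> separated_flags n \<phi>" by blast
  have lP: "l \<subseteq> points (flag_geometry n)" by (rule lines_subset_points[OF l])
  from l consider
    (pencil) p S where "subspace p" "dim p = 1" "subspace S" "dim S = n - 1" "p \<subseteq> S"
      "l = {(p, Z) | Z. subspace Z \<and> dim Z = n \<and> S \<subseteq> Z}"
  | (range) L H where "subspace L" "dim L = 2" "subspace H" "dim H = n" "L \<subseteq> H"
      "l = {(x, H) | x. subspace x \<and> dim x = 1 \<and> x \<subseteq> L}"
    unfolding flag_geometry_def by auto
  thus "l \<subseteq> separated_flags n \<phi>"
  proof cases
    case pencil
    obtain H1 H2 where H: "x = (p, H1)" "y = (p, H2)" "subspace H1" "subspace H2" "dim H1 = n"
      "dim H2 = n" "S \<subseteq> H1" "S \<subseteq> H2" using xy pencil by auto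
    obtain U1 U2 where U: "subspace U1" "coord_semilinear \<phi> ` U1 \<subseteq> U1" "p \<subseteq> U1" "U1 \<subseteq> H1"
      "subspace U2" "coord_semilinear \<phi> ` U2 \<subseteq> U2" "p \<subseteq> U2" "U2 \<subseteq> H2"
      using xy H by (auto simp: separated_flags_def)
    have sub: "subspace (H1 \<inter> H2)" by (intro subspace_inter H)
    \<comment> \<open>Two distinct hyperplanes through \<open>S\<close> meet exactly in
      \<open>S\<close>, so \<open>U1 \<inter> U2\<close> lies in every hyperplane of the
      pencil.\<close>
    have "dim (H1 \<inter> H2) \<noteq> n"
    proof
      assume "dim (H1 \<inter> H2) = n"
      hence "dim H1 \<le> dim (H1 \<inter> H2)" "dim H2 \<le> dim (H1 \<inter> H2)" using H by simp_all
      hence "H1 \<inter> H2 = H1" "H1 \<inter> H2 = H2"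
        using subspace_dim_equal[OF sub H(3)] subspace_dim_equal[OF sub H(4)] by blast+
      with H xy show False by simp
    qed
    moreover have "dim (H1 \<inter> H2) \<le> n" using dim_subset[of "H1 \<inter> H2" H1] H by simp
    ultimately have "dim (H1 \<inter> H2) \<le> dim S" using pencil by simp
    moreover have "S \<subseteq> H1 \<inter> H2" using H by blast
    ultimately have "S = H1 \<inter> H2" using subspace_dim_equal[OF pencil(3) sub] by blast
    hence "U1 \<inter> U2 \<subseteq> S" using U by auto
    moreover have "subspace (U1 \<inter> U2)" "coord_semilinear \<phi> ` (U1 \<inter> U2) \<subseteq> U1 \<inter> U2" "p \<subseteq> U1 \<inter> U2"
      using U by (auto intro: subspace_inter)
    ultimately have "\<exists>U. subspace U \<and> coord_semilinear \<phi> ` U \<subseteq> U \<and> p \<subseteq> U \<and> U \<subseteq> Z" if "S \<subseteq> Z" for Z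
      using that by (intro exI[of _ "U1 \<inter> U2"]) auto
    thus ?thesis using pencil(6) lP by (auto simp: separated_flags_def)
  next
    case range
    obtain p1 p2 where p: "x = (p1, H)" "y = (p2, H)" "subspace p1" "subspace p2" "dim p1 = 1"
      "dim p2 = 1" "p1 \<subseteq> L" "p2 \<subseteq> L" using xy range by auto
    obtain U1 U2 where U: "subspace U1" "coord_semilinear \<phi> ` U1 \<subseteq> U1" "p1 \<subseteq> U1" "U1 \<subseteq> H"
      "subspace U2" "coord_semilinear \<phi> ` U2 \<subseteq> U2" "p2 \<subseteq> U2" "U2 \<subseteq> H"
      using xy p by (auto simp: separated_flags_def)
    let ?U = "span (U1 \<union> U2)"
    have sub: "subspace (L \<inter> ?U)" by (intro subspace_inter range(1) subspace_span)
    \<comment> \<open>The sum contains two distinct points of \<open>L\<close>, hence all of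
      \<open>L\<close>.\<close>
    have "dim (L \<inter> ?U) \<noteq> 1"
    proof
      assume d: "dim (L \<inter> ?U) = 1"
      have "p1 \<subseteq> L \<inter> ?U" "p2 \<subseteq> L \<inter> ?U" using U p span_superset[of "U1 \<union> U2"] by auto
      moreover have "dim (L \<inter> ?U) \<le> dim p1" "dim (L \<inter> ?U) \<le> dim p2" using d p by simp_all
      ultimately have "p1 = L \<inter> ?U" "p2 = L \<inter> ?U"
        using subspace_dim_equal[OF p(3) sub] subspace_dim_equal[OF p(4) sub] by blast+
      with p xy show False by simp
    qed
    moreover have "dim p1 \<le> dim (L \<inter> ?U)"
      using U p span_superset[of "U1 \<union> U2"] by (intro dim_subset) auto
    ultimately have "dim L \<le> dim (L \<inter> ?U)" using range p by simp
    hence "L \<inter> ?U = L" using subspace_dim_equal[OF sub range(1)] by blast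
    moreover have "?U \<subseteq> H" using U range by (intro span_minimal) auto
    moreover have "coord_semilinear \<phi> ` ?U \<subseteq> ?U"
      using U span_superset[of "U1 \<union> U2"] by (intro coord_semilinear_span add mult) auto
    ultimately have "\<exists>U. subspace U \<and> coord_semilinear \<phi> ` U \<subseteq> U \<and> q \<subseteq> U \<and> U \<subseteq> H" if "q \<subseteq> L" for q
      using that by (intro exI[of _ ?U]) auto
    thus ?thesis using range(6) lP by (auto simp: separated_flags_def)
  qed
qed

text \<open>A homomorphism fixing all coordinates of the vectors in a finite set of flags puts that
  set into the separated flags, while some flag built from a moved scalar stays outside.\<close>

lemma infinite_generating_set:
  assumes n: "card Basis = n + 1" "n \<ge> 2"
    and hom: "\<And>T :: 'a set. finite T \<Longrightarrow> \<exists>\<phi>. (\<forall>a b. \<phi> (a + b) = \<phi> a + \<phi> b) \<and> (\<forall>a b. \<phi> (a * b) = \<phi> a * \<phi> b) \<and>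
      (\<forall>a\<in>T. \<phi> a = a) \<and> (\<exists>a. \<phi> a \<noteq> a) \<and> \<phi> 1 = 1"
    and S: "generates (flag_geometry n) S"
  shows "infinite S"
proof
  assume fin: "finite S"
  have SP: "S \<subseteq> points (flag_geometry n)" using S by (simp add: generates_def)
  have "\<forall>z\<in>S. \<exists>v f. z = flag v f \<and> f v = 0 \<and> lin_form f"
    using points_flag_geometry_normalised[OF _ n(1)] SP by blast
  then obtain v f where vf: "\<And>z. z \<in> S \<Longrightarrow> z = flag (v z) (f z) \<and> f z (v z) = 0 \<and> lin_form (f z)"
    by metis
  \<comment> \<open>Fixing the coordinates of the vectors suffices: \<open>span {v z}\<close> is
    then stable and separates the flag, whatever its hyperplane is.\<close>
  let ?T = "(\<lambda>(z, b). coord b (v z)) ` (S \<times> Basis)"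
  have "finite ?T"
    using fin finite_Basis by (intro finite_imageI finite_cartesian_product)
  from hom[OF this] obtain \<phi> where hom': "(\<forall>a b. \<phi> (a + b) = \<phi> a + \<phi> b) \<and>
      (\<forall>a b. \<phi> (a * b) = \<phi> a * \<phi> b) \<and> (\<forall>a\<in>?T. \<phi> a = a) \<and> (\<exists>a. \<phi> a \<noteq> a) \<and> \<phi> 1 = 1" ..
  then obtain t where t: "\<phi> t \<noteq> t" by blast
  have \<phi>: "\<phi> (a + b) = \<phi> a + \<phi> b" "\<phi> (a * b) = \<phi> a * \<phi> b"
    "\<phi> 1 = 1" for a b
    using hom' by simp_all
  have fixed: "\<phi> (coord b (v z)) = coord b (v z)" if "z \<in> S" "b \<in> Basis" for z b
    using hom' that by simp
  have "S \<subseteq> separated_flags n \<phi>"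
  proof
    fix z assume z: "z \<in> S"
    have "coord_semilinear \<phi> (v z) = v z" by (rule coord_semilinear_fixed) (use fixed z in auto)
    hence "coord_semilinear \<phi> ` span {v z} \<subseteq> span {v z}"
      by (intro coord_semilinear_span \<phi>) (auto intro: span_base)
    moreover have "span {v z} \<subseteq> {x. f z x = 0}"
      using vf[OF z] subspace_kernel by (intro span_minimal) auto
    ultimately have "\<exists>U. subspace U \<and> coord_semilinear \<phi> ` U \<subseteq> U \<and> span {v z} \<subseteq> U \<and> U \<subseteq> {x. f z x = 0}"
      by (intro exI[of _ "span {v z}"]) auto
    moreover have "z = (span {v z}, {x. f z x = 0})" using vf[OF z] by (simp add: flag_def)
    ultimately show "z \<in> separated_flags n \<phi>" using z SP unfolding separated_flags_def by auto
  qed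
  hence Y: "separated_flags n \<phi> = points (flag_geometry n)"
    using S geom_subspace_separated_flags[OF n(2) \<phi>(1,2)] by (auto simp: generates_def)
  have "\<not> card Basis \<le> Suc 0" using n by simp
  then obtain b c where bc: "b \<in> Basis" "c \<in> Basis" "b \<noteq> c"
    by (auto simp: card_le_Suc0_iff_eq finite_Basis)
  \<comment> \<open>The form vanishes at \<open>?v\<close>, but at the semilinear image
    \<open>b + scale (\<phi> t) c\<close> it takes the value \<open>t - \<phi> t\<close>. Hence no
    stable subspace separates this flag.\<close>
  let ?v = "b + scale t c" and ?g = "\<lambda>x. t * coord b x + (-1) * coord c x"
  have g: "lin_form ?g" by (intro lin_form_lincomb lin_form_coord)
  have co: "coord b ?v = 1" "coord c ?v = t"
    using bc by (auto simp: lin_form_add[OF lin_form_coord] lin_form_scale[OF lin_form_coord] coord_basis)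
  have "?v \<noteq> 0" using co lin_form_zero[OF lin_form_coord, of b] by auto
  moreover have "?g c \<noteq> 0" "?g ?v = 0" using bc co by (auto simp: coord_basis)
  ultimately have "flag ?v ?g \<in> separated_flags n \<phi>"
    unfolding Y using g n(1) by (intro flag_in_points)
  then obtain U where U: "coord_semilinear \<phi> ` U \<subseteq> U" "?v \<in> U" "U \<subseteq> {x. ?g x = 0}"
    using span_base[of ?v "{?v}"] by (auto simp: separated_flags_def flag_def)
  have "coord_semilinear \<phi> b = b" "coord_semilinear \<phi> c = c"
  proof -
    have "\<phi> 0 = 0" using \<phi>(1)[of 0 0] by (simp only: add_0 add_cancel_right_right)
    thus "coord_semilinear \<phi> b = b" "coord_semilinear \<phi> c = c"
      using bc \<phi>(3) by (auto intro!: coord_semilinear_fixed simp: coord_basis)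
  qed
  hence "coord_semilinear \<phi> ?v = b + scale (\<phi> t) c"
    by (simp add: coord_semilinear_add \<phi>(1,2) coord_semilinear_scale)
  hence "?g (b + scale (\<phi> t) c) = 0" using U by force
  hence "t = \<phi> t"
    using bc by (simp add: lin_form_add[OF lin_form_coord] lin_form_scale[OF lin_form_coord] coord_basis)
  with t show False by simp
qed

end

section \<open>Dependent flags\<close>

context finite_dimensional_vector_space
begin

text \<open>For distinct basis vectors this is, up to a scalar, the only combination of
  \<open>coord i\<close> and \<open>coord j\<close> that vanishes at
  \<open>i + scale a j\<close>.\<close>

definition pair_form :: "'b \<Rightarrow> 'b \<Rightarrow> 'a \<Rightarrow> 'b \<Rightarrow> 'a" where
  "pair_form i j a = (\<lambda>x. a * coord i x + (-1) * coord j x)"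

lemma lin_form_pair_form: "lin_form (pair_form i j a)"
  unfolding pair_form_def by (intro lin_form_lincomb lin_form_coord)

lemma pair_form_basis:
  assumes "i \<in> Basis" "j \<in> Basis" "i \<noteq> j" "k \<in> Basis"
  shows "pair_form i j a k = (if k = i then a else if k = j then -1 else 0)"
  using assms by (auto simp: pair_form_def coord_basis)

definition pair_flag :: "'b \<Rightarrow> 'b \<Rightarrow> 'a \<Rightarrow> 'b set \<times> 'b set" where
  "pair_flag i j a = flag (i + scale a j) (pair_form i j a)"

lemma coord_pair:
  assumes "i \<in> Basis" "j \<in> Basis" "i \<noteq> j"
  shows "coord i (i + scale a j) = 1" "coord j (i + scale a j) = a"
    "k \<in> Basis \<Longrightarrow> k \<noteq> i \<Longrightarrow> k \<noteq> j \<Longrightarrow> coord k (i + scale a j) = 0"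
  using assms
  by (auto simp: lin_form_add[OF lin_form_coord] lin_form_scale[OF lin_form_coord] coord_basis)

lemma pair_form_pair: 
  assumes "i \<in> Basis" "j \<in> Basis" "i \<noteq> j"
  shows "pair_form i j a (i + scale a j) = 0"
  using coord_pair[OF assms] by (simp add: pair_form_def)

text \<open>The pair flags for \<open>1\<close> and the single one for \<open>t\<close> are chosen
  to yield the pair flags of all powers of \<open>t\<close>.\<close>

definition generating_flags :: "'b \<Rightarrow> 'b \<Rightarrow> 'a \<Rightarrow> ('b set \<times> 'b set) set" where
  "generating_flags b c t = {flag i (coord j) | i j. i \<in> Basis \<and> j \<in> Basis \<and> i \<noteq> j} \<union>
     (\<lambda>j. pair_flag b j 1) ` (Basis - {b}) \<union> {pair_flag b c t}"

lemma pair_flag_in_points: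
  assumes "card Basis = n + 1" "i \<in> Basis" "j \<in> Basis" "i \<noteq> j"
  shows "pair_flag i j a \<in> points (flag_geometry n)"
  unfolding pair_flag_def
proof (rule flag_in_points[OF assms(1) lin_form_pair_form])
  show "i + scale a j \<noteq> 0"
    using coord_pair(1)[OF assms(2-4), of a] lin_form_zero[OF lin_form_coord, of i] by auto
  show "pair_form i j a j \<noteq> 0" using assms by (simp add: pair_form_basis)
qed (use pair_form_pair assms in auto)

lemma generating_flags_subset_points:
  assumes "card Basis = n + 1" "b \<in> Basis" "c \<in> Basis" "b \<noteq> c"
  shows "generating_flags b c t \<subseteq> points (flag_geometry n)"
proof -
  have "flag i (coord j) \<in> points (flag_geometry n)" if "i \<in> Basis" "j \<in> Basis" "i \<noteq> j" for i j
  proof (rule flag_in_points[OF assms(1) lin_form_coord])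
    show "i \<noteq> 0" using that coord_basis[of i i] lin_form_zero[OF lin_form_coord, of i] by auto
    show "coord j j \<noteq> 0" "coord j i = 0" using that by (auto simp: coord_basis)
  qed
  moreover have "pair_flag b j a \<in> points (flag_geometry n)" if "j \<in> Basis - {b}" for j a
    using pair_flag_in_points[OF assms(1,2), of j a] that by auto
  ultimately show ?thesis using assms(3,4) unfolding generating_flags_def by blast
qed

text \<open>The three families contribute at most \<open>(n + 1) * n\<close>, \<open>n\<close> and
  \<open>1\<close>. As this is an upper bound, coincidences among the flags do no harm.\<close>

lemma card_generating_flags:
  assumes n: "card Basis = n + 1" and "b \<in> Basis"
  shows "finite (generating_flags b c t) \<and> card (generating_flags b c t) \<le> (n + 1)\<^sup>2"
proof -
  let ?A = "(\<lambda>(i, j). flag i (coord j)) ` (SIGMA i:Basis. Basis - {i})"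
  let ?B = "(\<lambda>j. pair_flag b j 1) ` (Basis - {b})"
  have G: "generating_flags b c t = ?A \<union> ?B \<union> {pair_flag b c t}"
    unfolding generating_flags_def by force
  have "card (SIGMA i:Basis. Basis - {i}) = (\<Sum>i\<in>Basis. n)"
    using n finite_Basis by (subst card_SigmaI) auto
  hence A: "card ?A \<le> (n + 1) * n"
    using n card_image_le[of "SIGMA i:Basis. Basis - {i}" "\<lambda>(i, j). flag i (coord j)"] finite_Basis
    by simp
  have B: "card ?B \<le> n"
    using n assms(2) card_image_le[of "Basis - {b}" "\<lambda>j. pair_flag b j 1"] finite_Basis by simp
  have "card (generating_flags b c t) \<le> card ?A + card ?B + 1"
    unfolding G using card_Un_le[of "?A \<union> ?B" "{pair_flag b c t}"] card_Un_le[of ?A ?B] by simp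
  also have "\<dots> \<le> (n + 1)\<^sup>2" using A B by (simp add: power2_eq_square)
  finally have "card (generating_flags b c t) \<le> (n + 1)\<^sup>2" .
  moreover have "finite (generating_flags b c t)" unfolding G using finite_Basis by simp
  ultimately show ?thesis by simp
qed

section \<open>Consequences of containing all pairs of a basis vector and a different dual
  form\<close>

context
  fixes n Y
  assumes n: "card Basis = n + 1"
    and Y: "geom_subspace (flag_geometry n) Y"
    and std: "\<And>i j. i \<in> Basis \<Longrightarrow> j \<in> Basis \<Longrightarrow> i \<noteq> j \<Longrightarrow> flag_rel Y i (coord j)"
begin

lemma flag_rel_scale_form:
  assumes "flag_rel Y v f"
  shows "flag_rel Y v (\<lambda>x. a * f x)"
  using flag_rel_form_lincomb[OF Y n assms assms, of a 0] by simp

lemma flag_rel_scale_vector: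
  assumes "flag_rel Y v f"
  shows "flag_rel Y (scale a v) f"
  using flag_rel_vector_lincomb[OF Y n assms assms, of a 0] by simp

text \<open>Expanding \<open>v\<close> in the basis and \<open>f\<close> in the dual basis leaves
  only pairs of a basis vector with a different dual form, and these are given.\<close>

lemma flag_rel_disjoint_support:
  assumes f: "lin_form f" and disj: "\<And>b. b \<in> Basis \<Longrightarrow> coord b v = 0 \<or> f b = 0"
  shows "flag_rel Y v f"
proof -
  have "flag_rel Y (\<Sum>b\<in>Basis. scale (coord b v) b) f"
  proof (rule flag_rel_vector_sum[OF Y n f])
    fix b assume b: "b \<in> Basis"
    show "flag_rel Y (scale (coord b v) b) f"
    proof (cases "coord b v = 0")
      case True
      thus ?thesis using flag_rel_zero[OF f] by simp
    next
      case False
      hence fb: "f b = 0" using disj b by blast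
      have "flag_rel Y b (\<lambda>x. \<Sum>k\<in>Basis. f k * coord k x)"
      proof (rule flag_rel_form_sum[OF Y n])
        fix k assume k: "k \<in> Basis"
        show "flag_rel Y b (\<lambda>x. f k * coord k x)"
        proof (cases "k = b")
          case True
          thus ?thesis using fb by (auto simp: flag_rel_def lin_form_def)
        next
          case False
          thus ?thesis using std b k by (intro flag_rel_scale_form) auto
        qed
      qed
      also have "(\<lambda>x. \<Sum>k\<in>Basis. f k * coord k x) = f"
        by (rule ext) (rule lin_form_expand[OF f, symmetric])
      finally show ?thesis by (rule flag_rel_scale_vector)
    qed
  qed
  thus ?thesis by (simp add: sum_coord)
qed

text \<open>One suitable vector is enough to pair the form with its whole kernel.\<close>

lemma flag_rel_pair_form:
  assumes ij: "i \<in> Basis" "j \<in> Basis" "i \<noteq> j"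
    and E: "flag_rel Y (i + scale a j) (pair_form i j a)"
    and v: "pair_form i j a v = 0"
  shows "flag_rel Y v (pair_form i j a)"
proof -
  \<comment> \<open>Clearing the coordinate at \<open>i\<close> clears the one at \<open>j\<close>
    too, because the form vanishes at \<open>v\<close>. The remainder has support disjoint from the
    form.\<close>
  let ?w = "v - scale (coord i v) (i + scale a j)"
  have cw: "coord i ?w = 0" "coord j ?w = 0"
    using coord_pair[OF ij, where a = a] v
    by (simp_all add: lin_form_diff[OF lin_form_coord] lin_form_scale[OF lin_form_coord]
        pair_form_def mult.commute)
  have "flag_rel Y ?w (pair_form i j a)"
    using cw ij by (intro flag_rel_disjoint_support lin_form_pair_form) (auto simp: pair_form_basis)
  from flag_rel_vector_lincomb[OF Y n E this, of "coord i v" 1] show ?thesis by simp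
qed

text \<open>At \<open>i + scale a j + scale (a * b) k\<close> both forms vanish, and
  \<open>b\<close> times the first plus the second eliminates \<open>coord j\<close>. The term
  \<open>scale a j\<close> can then be removed, since \<open>j\<close> and the new form have
  disjoint supports.\<close>

lemma flag_rel_pair_mult:
  assumes ijk: "i \<in> Basis" "j \<in> Basis" "k \<in> Basis" "i \<noteq> j" "j \<noteq> k" "i \<noteq> k"
    and E: "flag_rel Y (i + scale a j) (pair_form i j a)"
      "flag_rel Y (j + scale b k) (pair_form j k b)"
  shows "flag_rel Y (i + scale (a * b) k) (pair_form i k (a * b))"
proof -
  let ?v = "i + scale a j + scale (a * b) k"
  have co: "coord i ?v = 1" "coord j ?v = a" "coord k ?v = a * b"
    using ijk by (auto simp: lin_form_add[OF lin_form_coord] lin_form_scale[OF lin_form_coord] coord_basis)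
  have "flag_rel Y ?v (pair_form i j a)" "flag_rel Y ?v (pair_form j k b)"
    using flag_rel_pair_form[OF ijk(1,2,4) E(1), of ?v] flag_rel_pair_form[OF ijk(2,3,5) E(2), of ?v] co
    by (simp_all add: pair_form_def mult.commute)
  from flag_rel_form_lincomb[OF Y n this, of b 1]
  have "flag_rel Y ?v (pair_form i k (a * b))"
    by (simp add: pair_form_def algebra_simps)
  moreover have "flag_rel Y j (pair_form i k (a * b))"
    using ijk by (intro flag_rel_disjoint_support lin_form_pair_form) (auto simp: coord_basis pair_form_basis)
  ultimately have "flag_rel Y (scale 1 ?v + scale (- a) j) (pair_form i k (a * b))"
    by (rule flag_rel_vector_lincomb[OF Y n])
  thus ?thesis by simp
qed

text \<open>For the scalar \<open>1\<close>, exchanging the indices keeps the vector and negates the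
  form.\<close>

lemma flag_rel_pair_one_sym:
  assumes "flag_rel Y (i + scale 1 j) (pair_form i j 1)"
  shows "flag_rel Y (j + scale 1 i) (pair_form j i 1)"
  using flag_rel_scale_form[OF assms, of "-1"]
  by (simp add: pair_form_def add.commute)

text \<open>The scalar \<open>1\<close> is first spread over all ordered pairs through
  \<open>b\<close>. Multiplication by it moves \<open>t\<close> from \<open>(b, c)\<close> to every
  ordered pair, and a detour through a third index then raises the exponent by one.\<close>

lemma flag_rel_pair_powers:
  assumes bc: "b \<in> Basis" "c \<in> Basis" "b \<noteq> c"
    and one: "\<And>j. j \<in> Basis \<Longrightarrow> j \<noteq> b \<Longrightarrow> flag_rel Y (b + scale 1 j) (pair_form b j 1)"
    and t: "flag_rel Y (b + scale t c) (pair_form b c t)"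
    and big: "card Basis \<ge> 3"
    and ij: "i \<in> Basis" "j \<in> Basis" "i \<noteq> j"
  shows "flag_rel Y (i + scale (t ^ m) j) (pair_form i j (t ^ m))"
  using ij
proof (induction m arbitrary: i j)
  \<comment> \<open>Multiplication takes three distinct indices; here the lower bound on the size of
    the basis enters.\<close>
  have third: "\<exists>k\<in>Basis. k \<noteq> i \<and> k \<noteq> j" for i j
  proof (rule ccontr)
    assume "\<not> ?thesis"
    hence "Basis \<subseteq> {i, j}" by auto
    hence "card Basis \<le> card {i, j}" by (rule card_mono[rotated]) simp
    also have "\<dots> \<le> 2" by (simp add: card_insert_if)
    finally show False using big by simp
  qed
  have one': "flag_rel Y (i + scale 1 j) (pair_form i j 1)" if "i \<in> Basis" "j \<in> Basis" "i \<noteq> j" for i j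
  proof -
    consider "i = b" | "j = b" | "i \<noteq> b" "j \<noteq> b" by blast
    thus ?thesis
    proof cases
      case 1
      thus ?thesis using one that by auto
    next
      case 2
      thus ?thesis using flag_rel_pair_one_sym one that by auto
    next
      case 3
      thus ?thesis
        using flag_rel_pair_mult[of i b j 1 1] flag_rel_pair_one_sym[OF one[of i]] one[of j] that bc
        by simp
    qed
  qed
  have tb: "flag_rel Y (b + scale t j) (pair_form b j t)" if "j \<in> Basis" "j \<noteq> b" for j
  proof (cases "j = c")
    case False
    thus ?thesis using flag_rel_pair_mult[of b c j t 1] t one'[of c j] that bc by simp
  qed (use t in simp)
  have ti: "flag_rel Y (i + scale t j) (pair_form i j t)" if "i \<in> Basis" "j \<in> Basis" "i \<noteq> j" "j \<noteq> b" for i j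
  proof (cases "i = b")
    case False
    thus ?thesis using flag_rel_pair_mult[of i b j 1 t] one'[of i b] tb[of j] that bc by simp
  qed (use tb that in simp)
  have t': "flag_rel Y (i + scale t j) (pair_form i j t)" if "i \<in> Basis" "j \<in> Basis" "i \<noteq> j" for i j
  proof (cases "j = b")
    case True
    \<comment> \<open>A pair ending in \<open>b\<close> cannot be routed through \<open>b\<close>,
      so another intermediate index is taken.\<close>
    obtain k where k: "k \<in> Basis" "k \<noteq> i" "k \<noteq> b" using third by metis
    thus ?thesis using flag_rel_pair_mult[of i k b t 1] ti[of i k] one'[of k b] that bc True by simp
  qed (use ti that in simp)
  {
    case 0
    thus ?case using one' by simp
  next
    case (Suc m)
    obtain k where k: "k \<in> Basis" "k \<noteq> i" "k \<noteq> j" using third by metis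
    thus ?case using flag_rel_pair_mult[of i k j t "t ^ m"] t'[of i k] Suc by simp
  }
qed

text \<open>When coordinate \<open>i\<close> of \<open>v\<close> is \<open>1\<close>, the forms
  \<open>pair_form i k (coord k v)\<close> with \<open>k \<noteq> i\<close> are a basis of the forms
  vanishing at \<open>v\<close>.\<close>

lemma flag_rel_of_pairs:
  assumes i: "i \<in> Basis" "coord i v = 1" and f: "lin_form f" "f v = 0"
    and E: "\<And>k. k \<in> Basis \<Longrightarrow> k \<noteq> i \<Longrightarrow>
      flag_rel Y (i + scale (coord k v) k) (pair_form i k (coord k v))"
  shows "flag_rel Y v f"
proof -
  have "flag_rel Y v (\<lambda>x. \<Sum>k\<in>Basis - {i}. (- f k) * pair_form i k (coord k v) x)"
  proof (rule flag_rel_form_sum[OF Y n])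
    fix k assume k: "k \<in> Basis - {i}"
    have "flag_rel Y v (pair_form i k (coord k v))"
    proof (rule flag_rel_pair_form)
      show "flag_rel Y (i + scale (coord k v) k) (pair_form i k (coord k v))" using E k by auto
      show "pair_form i k (coord k v) v = 0" using i by (simp add: pair_form_def)
    qed (use i k in auto)
    thus "flag_rel Y v (\<lambda>x. (- f k) * pair_form i k (coord k v) x)"
      by (rule flag_rel_scale_form)
  qed
  also have "(\<lambda>x. \<Sum>k\<in>Basis - {i}. (- f k) * pair_form i k (coord k v) x) = f"
  proof
    fix x
    have expand: "f y = f i * coord i y + (\<Sum>k\<in>Basis - {i}. f k * coord k y)" for y
      using i by (subst lin_form_expand[OF f(1)]) (simp add: sum.remove[OF finite_Basis, of i])
    \<comment> \<open>The coefficients at \<open>coord k\<close> agree by the choice of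
      \<open>- f k\<close>; the one at \<open>coord i\<close> agrees because
      \<open>f v = 0\<close>.\<close>
    have "f i + (\<Sum>k\<in>Basis - {i}. f k * coord k v) = f v"
      using i by (subst expand) simp
    hence fi: "f i = - (\<Sum>k\<in>Basis - {i}. f k * coord k v)" using f by (simp add: eq_neg_iff_add_eq_0)
    have "(\<Sum>k\<in>Basis - {i}. (- f k) * pair_form i k (coord k v) x) =
      (\<Sum>k\<in>Basis - {i}. f k * coord k x) - (\<Sum>k\<in>Basis - {i}. f k * coord k v) * coord i x"
      by (simp add: pair_form_def algebra_simps sum_subtractf sum_distrib_left)
    also have "\<dots> = f i * coord i x + (\<Sum>k\<in>Basis - {i}. f k * coord k x)" by (subst fi) (simp add: algebra_simps)
    also have "\<dots> = f x" by (rule expand[symmetric])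
    finally show "(\<Sum>k\<in>Basis - {i}. (- f k) * pair_form i k (coord k v) x) = f x" .
  qed
  finally show ?thesis .
qed

end

text \<open>The normalised vectors of finitely many flags have finitely many coordinates, all of
  them \<open>0\<close> or powers of one \<open>t\<close>. The generating flags are taken for this
  \<open>t\<close>.\<close>

lemma finite_flags_dependent:
  assumes n: "card Basis = n + 1" "n \<ge> 2"
    and gen: "\<And>T :: 'a set. finite T \<Longrightarrow> \<exists>t. \<forall>x\<in>T. x = 0 \<or> (\<exists>m. x = t ^ m)"
    and S: "finite S" "S \<subseteq> points (flag_geometry n)"
  shows "\<exists>G\<subseteq>points (flag_geometry n). finite G \<and> card G \<le> (n + 1)\<^sup>2 \<and>
    (\<forall>Y. geom_subspace (flag_geometry n) Y \<and> G \<subseteq> Y \<longrightarrow> S \<subseteq> Y)"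
proof -
  have "\<not> card Basis \<le> Suc 0" using n by simp
  then obtain b c where bc: "b \<in> Basis" "c \<in> Basis" "b \<noteq> c"
    by (auto simp: card_le_Suc0_iff_eq finite_Basis)
  have "\<forall>z\<in>S. \<exists>v f i. z = flag v f \<and> i \<in> Basis \<and> coord i v = 1 \<and> lin_form f \<and> (\<exists>x. f x \<noteq> 0) \<and> f v = 0"
    using points_flag_geometry_normalised[OF _ n(1)] S by blast
  then obtain v f i where vf: "\<And>z. z \<in> S \<Longrightarrow> z = flag (v z) (f z) \<and> i z \<in> Basis \<and>
      coord (i z) (v z) = 1 \<and> lin_form (f z) \<and> (\<exists>x. f z x \<noteq> 0) \<and> f z (v z) = 0" by metis
  have "finite ((\<lambda>(z, b). coord b (v z)) ` (S \<times> Basis))"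
    using S finite_Basis by (intro finite_imageI finite_cartesian_product)
  from gen[OF this] obtain t where
    t: "\<And>z b. z \<in> S \<Longrightarrow> b \<in> Basis \<Longrightarrow> coord b (v z) = 0 \<or> (\<exists>m. coord b (v z) = t ^ m)"
    by auto
  let ?G = "generating_flags b c t"
  have "S \<subseteq> Y" if Y: "geom_subspace (flag_geometry n) Y" and G: "?G \<subseteq> Y" for Y
  proof
    fix z assume z: "z \<in> S"
    have std: "flag_rel Y i (coord j)" if "i \<in> Basis" "j \<in> Basis" "i \<noteq> j" for i j
      using G that lin_form_coord by (auto simp: flag_rel_def generating_flags_def coord_basis)
    have one: "flag_rel Y (b + scale 1 j) (pair_form b j 1)" if "j \<in> Basis" "j \<noteq> b" for j
    proof -
      have "pair_flag b j 1 \<in> Y" using G that by (auto simp: generating_flags_def)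
      thus ?thesis unfolding flag_rel_def pair_flag_def
        using pair_form_pair[of b j 1] that bc lin_form_pair_form by auto
    qed
    have "pair_flag b c t \<in> Y" using G by (auto simp: generating_flags_def)
    hence tt: "flag_rel Y (b + scale t c) (pair_form b c t)"
      unfolding flag_rel_def pair_flag_def using pair_form_pair[OF bc] lin_form_pair_form by auto
    have "flag_rel Y (v z) (f z)"
    proof (rule flag_rel_of_pairs[OF n(1) Y std])
      fix k assume k: "k \<in> Basis" "k \<noteq> i z"
      show "flag_rel Y (i z + scale (coord k (v z)) k) (pair_form (i z) k (coord k (v z)))"
      proof (cases "coord k (v z) = 0")
        case True
        \<comment> \<open>A zero coordinate need not be a power of \<open>t\<close>; its pair form
          is minus a dual form and comes from a standard pair.\<close>
        have "flag_rel Y (i z) (\<lambda>x. (-1) * coord k x)"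
          using flag_rel_scale_form[OF n(1) Y std, of "i z" "coord k" "-1"] std[of "i z" k] k vf[OF z]
          by auto
        thus ?thesis using True by (simp add: pair_form_def)
      next
        case False
        then obtain m where "coord k (v z) = t ^ m" using t[OF z k(1)] by blast
        thus ?thesis
          using flag_rel_pair_powers[OF n(1) Y std bc one tt, of "i z" k m] n k vf[OF z] by auto
      qed
    qed (use vf[OF z] in auto)
    moreover have "v z \<noteq> 0" using vf[OF z] lin_form_zero[OF lin_form_coord, of "i z"] by auto
    ultimately show "z \<in> Y" using vf[OF z] by (auto simp: flag_rel_def)
  qed
  thus ?thesis
    using generating_flags_subset_points[OF n(1) bc, of t] card_generating_flags[OF n(1) bc(1), of c t]
    by blast
qed

end

section \<open>Transport along injections\<close>

text \<open>A copy of the field inside the type \<open>'d\<close>, because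
  \<open>embedding_rank\<close> prescribes the types of scalars and vectors.\<close>

definition image_field :: "('a::field \<Rightarrow> 'd) \<Rightarrow> 'd ring" where
  "image_field f = \<lparr>carrier = range f, monoid.mult = (\<lambda>x y. f (inv_into UNIV f x * inv_into UNIV f y)),
     monoid.one = f 1, ring.zero = f 0, ring.add = (\<lambda>x y. f (inv_into UNIV f x + inv_into UNIV f y))\<rparr>"

text \<open>Only \<open>U\<close> is copied, so that injectivity of \<open>g\<close> on
  \<open>U\<close> suffices; the ambient type may be too large to inject into
  \<open>'w\<close>.\<close>

definition (in vector_space) image_space ::
    "('a \<Rightarrow> 'd) \<Rightarrow> ('b \<Rightarrow> 'w) \<Rightarrow> 'b set \<Rightarrow> ('d, 'w) module" where
  "image_space f g U = \<lparr>carrier = g ` U, monoid.mult = undefined, monoid.one = undefined, ring.zero = g 0,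
     ring.add = (\<lambda>x y. g (inv_into U g x + inv_into U g y)),
     module.smult = (\<lambda>a x. g (scale (inv_into UNIV f a) (inv_into U g x)))\<rparr>"

lemma skew_field_image_field:
  assumes f: "inj f"
  shows "skew_field (image_field f)"
proof -
  have inv: "inv_into UNIV f (f x) = x" for x using f by simp
  have C: "carrier (image_field f) = range f"
    "x \<otimes>\<^bsub>image_field f\<^esub> y = f (inv_into UNIV f x * inv_into UNIV f y)"
    "x \<oplus>\<^bsub>image_field f\<^esub> y = f (inv_into UNIV f x + inv_into UNIV f y)"
    "\<one>\<^bsub>image_field f\<^esub> = f 1" "\<zero>\<^bsub>image_field f\<^esub> = f 0"
    for x y by (simp_all add: image_field_def)
  have neg: "\<exists>y. f (x + y) = f 0" for x by (rule exI[of _ "- x"]) simp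
  have "ring (image_field f)"
    by (intro ringI abelian_groupI monoidI) (auto simp: C inv algebra_simps neg)
  moreover have "f x \<in> Units (image_field f)" if "f x \<noteq> f 0" for x
  proof -
    have "x \<noteq> 0" using that by auto
    thus ?thesis by (auto simp: Units_def C inv intro!: exI[of _ "inverse x"])
  qed
  moreover have "f 1 \<noteq> f 0" using injD[OF f, of 1 0] by auto
  ultimately show ?thesis
    unfolding skew_field_def skew_field_axioms_def by (auto simp: C)
qed

context vector_space
begin

context
  fixes f :: "'a \<Rightarrow> 'd" and g :: "'b \<Rightarrow> 'w" and U
  assumes f: "inj f" and g: "inj_on g U" and U: "subspace U"
begin

private abbreviation "R \<equiv> image_field f"
private abbreviation "W \<equiv> image_space f g U"

lemma inv_f: "inv_into UNIV f (f x) = x"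
  using f by simp

lemma inv_g: "x \<in> U \<Longrightarrow> inv_into U g (g x) = x"
  using g by simp

lemma image_space_simps:
  "carrier W = g ` U" "\<zero>\<^bsub>W\<^esub> = g 0" "carrier R = range f"
  "x \<in> U \<Longrightarrow> y \<in> U \<Longrightarrow> g x \<oplus>\<^bsub>W\<^esub> g y = g (x + y)"
  "x \<in> U \<Longrightarrow> f c \<odot>\<^bsub>W\<^esub> g x = g (scale c x)"
  "f c \<oplus>\<^bsub>R\<^esub> f d = f (c + d)" "f c \<otimes>\<^bsub>R\<^esub> f d = f (c * d)" "\<one>\<^bsub>R\<^esub> = f 1"
  by (simp_all add: image_space_def image_field_def inv_f inv_g)

lemma left_vector_space_image_space: "left_vector_space R W"
proof -
  have cl: "0 \<in> U" "x \<in> U \<Longrightarrow> y \<in> U \<Longrightarrow> x + y \<in> U" "x \<in> U \<Longrightarrow> scale c x \<in> U" for x y c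
    using U by (auto intro: subspace_0 subspace_add subspace_scale)
  have neg: "\<exists>y\<in>U. g (x + y) = g 0" if "x \<in> U" for x
    using subspace_neg[OF U that] by (intro bexI[of _ "- x"]) auto
  have "abelian_group W"
    by (intro abelian_groupI) (auto simp: image_space_simps cl algebra_simps neg)
  thus ?thesis
    unfolding left_vector_space_def left_vector_space_axioms_def
    using skew_field_image_field[OF f]
    by (auto simp: image_space_simps cl scale_left_distrib scale_right_distrib)
qed

interpretation W: left_vector_space R W
  by (rule left_vector_space_image_space)

text \<open>Through this correspondence spans and dimensions of the copy are computed in the
  original space.\<close>

lemma submodule_image_iff: "submodule Z R W \<longleftrightarrow> (\<exists>S\<subseteq>U. subspace S \<and> Z = g ` S)"
proof
  assume Z: "submodule Z R W"
  let ?S = "{x \<in> U. g x \<in> Z}"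
  have "subspace ?S"
    unfolding subspace_def
  proof (intro conjI ballI allI)
    show "0 \<in> ?S" using W.submodule_zero[OF Z] subspace_0[OF U] by (simp add: image_space_simps)
    show "x + y \<in> ?S" if "x \<in> ?S" "y \<in> ?S" for x y
      using W.submodule_add[OF Z, of "g x" "g y"] that subspace_add[OF U]
      by (simp add: image_space_simps)
    show "scale c x \<in> ?S" if "x \<in> ?S" for c x
      using W.submodule_smult[OF Z, of "f c" "g x"] that subspace_scale[OF U]
      by (simp add: image_space_simps)
  qed
  moreover have "Z = g ` ?S" using W.submodule_carrier[OF Z] by (auto simp: image_space_simps)
  ultimately show "\<exists>S\<subseteq>U. subspace S \<and> Z = g ` S" by (intro exI[of _ ?S]) auto
next
  assume "\<exists>S\<subseteq>U. subspace S \<and> Z = g ` S"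
  then obtain S where S: "S \<subseteq> U" "subspace S" "Z = g ` S" by blast
  show "submodule Z R W"
  proof (rule W.submoduleI)
    show "\<zero>\<^bsub>W\<^esub> \<in> Z" using S subspace_0 by (simp add: image_space_simps)
    show "x \<oplus>\<^bsub>W\<^esub> y \<in> Z" if xy: "x \<in> Z" "y \<in> Z" for x y
    proof -
      obtain u v where "u \<in> S" "v \<in> S" "x = g u" "y = g v" using xy S by blast
      thus ?thesis using S subspace_add[OF S(2)] by (auto simp: image_space_simps subset_iff)
    qed
    show "a \<odot>\<^bsub>W\<^esub> x \<in> Z" if ax: "a \<in> carrier R" "x \<in> Z" for a x
    proof -
      obtain c u where "u \<in> S" "x = g u" "a = f c" using ax S by (auto simp: image_space_simps)
      thus ?thesis using S subspace_scale[OF S(2)] by (auto simp: image_space_simps subset_iff)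
    qed
  qed (use S in \<open>auto simp: image_space_simps\<close>)
qed

lemma span_subset_U: "A \<subseteq> U \<Longrightarrow> span A \<subseteq> U"
  using U by (rule span_minimal[rotated])

lemma image_subset_image_iff: "A \<subseteq> U \<Longrightarrow> B \<subseteq> U \<Longrightarrow> g ` A \<subseteq> g ` B \<longleftrightarrow> A \<subseteq> B"
  using inj_on_image_mem_iff[OF g] by blast

lemma lin_span_image:
  assumes A: "A \<subseteq> U"
  shows "lin_span R W (g ` A) = g ` span A"
proof
  have "submodule (g ` span A) R W"
    using A span_subset_U subspace_span by (subst submodule_image_iff) blast
  thus "lin_span R W (g ` A) \<subseteq> g ` span A"
    by (rule W.lin_span_minimal) (auto intro: span_base)
  have "submodule (lin_span R W (g ` A)) R W"
    using A by (intro W.submodule_lin_span) (auto simp: image_space_simps)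
  then obtain S where S: "S \<subseteq> U" "subspace S" "lin_span R W (g ` A) = g ` S"
    using submodule_image_iff by blast
  have "g ` A \<subseteq> g ` S" using W.lin_span_superset[of "g ` A"] S by simp
  hence "A \<subseteq> S" using A S(1) image_subset_image_iff by blast
  hence "span A \<subseteq> S" using S(2) by (rule span_minimal)
  thus "g ` span A \<subseteq> lin_span R W (g ` A)" using S by auto
qed

lemma lin_dim_image:
  assumes B: "B \<subseteq> U" "finite B" "independent B"
  shows "lin_dim R W (g ` span B) = enat (card B)"
proof -
  have sub: "submodule (g ` span B) R W"
    using B span_subset_U subspace_span by (subst submodule_image_iff) blast
  have gB: "inj_on g B" using g B inj_on_subset by blast
  have "is_basis R W (g ` span B) (g ` B)"
    unfolding is_basis_def
  proof (intro conjI ballI)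
    show "g ` B \<subseteq> g ` span B" using span_superset by auto
    show "lin_span R W (g ` B) = g ` span B" using B lin_span_image by blast
    fix x assume "x \<in> g ` B"
    then obtain b where b: "x = g b" "b \<in> B" by blast
    have "g ` B - {x} = g ` (B - {b})" using gB b by (auto simp: inj_on_def)
    hence "lin_span R W (g ` B - {x}) = g ` span (B - {b})"
      using B lin_span_image[of "B - {b}"] by auto
    moreover have "b \<notin> span (B - {b})" using B(3) b by (auto simp: dependent_def)
    hence "g b \<notin> g ` span (B - {b})"
      using inj_on_image_mem_iff[OF g, of b "span (B - {b})"] span_subset_U[of "B - {b}"] b B by auto
    ultimately show "x \<notin> lin_span R W (g ` B - {x})" using b by simp
  qed
  from W.lin_dim_eq_card[OF this _ sub] B(2) gB show ?thesis by (simp add: card_image)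
qed

section \<open>Points and lines of the copied projective space\<close>

lemma PG_points_image: "points (PG R W) = {g ` span {h} | h. h \<in> U \<and> h \<noteq> 0}"
proof (intro equalityI subsetI)
  fix x assume "x \<in> points (PG R W)"
  then obtain w where w: "W.lin_indep {w}" "x = lin_span R W {w}" using W.PG_pointD by blast
  then obtain h where h: "h \<in> U" "w = g h" by (auto simp: W.lin_indep_def image_space_simps)
  have "w \<notin> lin_span R W (g ` {})" using w by (simp add: W.lin_indep_def)
  hence "h \<noteq> 0" using lin_span_image[of "{}"] h by auto
  moreover have "x = g ` span {h}" using lin_span_image[of "{h}"] h w by simp
  ultimately show "x \<in> {g ` span {h} | h. h \<in> U \<and> h \<noteq> 0}" using h by blast
next
  fix x assume "x \<in> {g ` span {h} | h. h \<in> U \<and> h \<noteq> 0}"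
  then obtain h where h: "h \<in> U" "h \<noteq> 0" "x = g ` span {h}" by blast
  have "submodule x R W"
    using h span_subset_U[of "{h}"] subspace_span by (subst submodule_image_iff) blast
  moreover have "lin_dim R W x = 1" using lin_dim_image[of "{h}"] h by (simp add: one_enat_def)
  ultimately show "x \<in> points (PG R W)" by (simp add: PG_def)
qed

text \<open>The line through two points, parametrised by coefficients; images of lines of flags will
  have this form.\<close>

lemma PG_line_image:
  assumes h: "h1 \<in> U" "h2 \<in> U" and ind: "\<And>a b. scale a h1 + scale b h2 = 0 \<Longrightarrow> a = 0 \<and> b = 0"
  shows "{g ` span {scale a h1 + scale b h2} | a b. a \<noteq> 0 \<or> b \<noteq> 0} \<in> lines (PG R W)"
proof -
  have ne: "h1 \<noteq> h2" "h2 \<noteq> 0" using ind[of 1 "-1"] ind[of 0 1] by auto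
  have "h1 \<notin> span {h2}" using ind[of 1 "- c" for c] by (auto simp: span_singleton)
  hence "independent {h1, h2}" using ne by (simp add: independent_insert)
  hence "lin_dim R W (g ` span {h1, h2}) = 2"
    using lin_dim_image[of "{h1, h2}"] h ne by (simp add: numeral_eq_enat)
  moreover have sub: "submodule (g ` span {h1, h2}) R W"
    using h span_subset_U[of "{h1, h2}"] subspace_span by (subst submodule_image_iff) blast
  moreover have "{x. submodule x R W \<and> lin_dim R W x = 1 \<and> x \<subseteq> g ` span {h1, h2}} =
      {g ` span {scale a h1 + scale b h2} | a b. a \<noteq> 0 \<or> b \<noteq> 0}" (is "?X = ?Y")
  proof -
    have span2: "span {h1, h2} = {scale a h1 + scale b h2 | a b. True}"
      by (auto simp: span_insert span_singleton) (metis add_diff_cancel_left' diff_add_cancel)+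
    have "?X = {x \<in> points (PG R W). x \<subseteq> g ` span {h1, h2}}" by (auto simp: PG_def)
    also have "\<dots> = {g ` span {h} | h. h \<in> span {h1, h2} \<and> h \<noteq> 0}"
    proof -
      have "g ` span {h} \<subseteq> g ` span {h1, h2} \<longleftrightarrow> h \<in> span {h1, h2}" if "h \<in> U" for h
      proof -
        have "g ` span {h} \<subseteq> g ` span {h1, h2} \<longleftrightarrow> span {h} \<subseteq> span {h1, h2}"
          using that h by (intro image_subset_image_iff span_subset_U) auto
        also have "\<dots> \<longleftrightarrow> h \<in> span {h1, h2}" by (metis empty_subsetI insert_subset span_minimal
          span_superset subset_trans subspace_span)
        finally show ?thesis .
      qed
      moreover have "span {h1, h2} \<subseteq> U" using h by (intro span_subset_U) auto
      ultimately show ?thesis unfolding PG_points_image by blast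
    qed
    also have "\<dots> = ?Y"
    proof -
      have "scale a h1 + scale b h2 \<noteq> 0 \<longleftrightarrow> a \<noteq> 0 \<or> b \<noteq> 0" for a b
        using ind[of a b] by auto
      thus ?thesis unfolding span2 by blast
    qed
    finally show ?thesis .
  qed
  ultimately show ?thesis
    unfolding PG_def geometry.simps by (intro CollectI exI[of _ "g ` span {h1, h2}"] conjI) simp_all
qed

end

end

section \<open>The embedding into traceless matrices\<close>

lemma sum_fun_apply: "(\<Sum>i\<in>I. h i) x = (\<Sum>i\<in>I. h i x)"
  for h :: "'i \<Rightarrow> 'x \<Rightarrow> 'y::comm_monoid_add"
  by (induction I rule: infinite_finite_induct) auto

context finite_dimensional_vector_space
begin

text \<open>For a linear form \<open>f\<close> this is the endomorphism \<open>v \<otimes> f\<close>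
  of rank at most one. Its trace is \<open>f v\<close>, so flags give traceless
  endomorphisms.\<close>

definition tensor :: "'b \<Rightarrow> ('b \<Rightarrow> 'a) \<Rightarrow> 'b \<Rightarrow> 'b" where
  "tensor v f = (\<lambda>x. scale (f x) v)"

text \<open>The ambient space consists of all maps under pointwise operations; the traceless
  endomorphisms appear in it as a span.\<close>

sublocale endo: vector_space "\<lambda>c (h :: 'b \<Rightarrow> 'b) x. scale c (h x)"
  by unfold_locales (auto simp: scale_left_distrib scale_right_distrib fun_eq_iff)

lemma tensor_scale_left: "tensor (scale c v) f = (\<lambda>x. scale c (tensor v f x))"
  by (simp add: tensor_def mult.commute)

lemma tensor_lincomb_left:
  "tensor (scale a v + scale b w) f = (\<lambda>x. scale a (tensor v f x)) + (\<lambda>x. scale b (tensor w f x))"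
  by (simp add: tensor_def fun_eq_iff scale_right_distrib mult.commute)

lemma tensor_lincomb_right:
  "tensor v (\<lambda>x. a * f x + b * g x) = (\<lambda>x. scale a (tensor v f x)) + (\<lambda>x. scale b (tensor v g x))"
  by (simp add: tensor_def fun_eq_iff scale_left_distrib)

lemma tensor_eq_0_iff: "tensor v f = 0 \<longleftrightarrow> v = 0 \<or> (\<forall>x. f x = 0)"
  by (auto simp: tensor_def fun_eq_iff)

text \<open>The matrix units, with the diagonal ones made traceless by subtracting the one at \<open>b\<close>.\<close>

definition traceless_unit :: "'b \<Rightarrow> 'b \<times> 'b \<Rightarrow> 'b \<Rightarrow> 'b" where
  "traceless_unit b = (\<lambda>(i, j). tensor i (coord j) - (if i = j then tensor b (coord b) else 0))"

definition traceless_units :: "'b \<Rightarrow> ('b \<Rightarrow> 'b) set" where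
  "traceless_units b = traceless_unit b ` (Basis \<times> Basis - {(b, b)})"

text \<open>Away from position \<open>(b, b)\<close> the correction term vanishes, so each matrix
  entry detects exactly one unit. This yields injectivity and independence.\<close>

lemma coord_traceless_unit:
  assumes "b \<in> Basis" "i \<in> Basis" "j \<in> Basis" "k \<in> Basis" "l \<in> Basis" "(k, l) \<noteq> (b, b)"
  shows "coord k (traceless_unit b (i, j) l) = (if (i, j) = (k, l) then 1 else 0)"
  using assms
  by (auto simp: traceless_unit_def tensor_def lin_form_diff[OF lin_form_coord]
      lin_form_scale[OF lin_form_coord] lin_form_zero[OF lin_form_coord] coord_basis)

lemma inj_on_traceless_unit:
  assumes "b \<in> Basis"
  shows "inj_on (traceless_unit b) (Basis \<times> Basis - {(b, b)})"
proof (rule inj_onI)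
  fix x y assume x: "x \<in> Basis \<times> Basis - {(b, b)}" and y: "y \<in> Basis \<times> Basis - {(b, b)}"
    and eq: "traceless_unit b x = traceless_unit b y"
  obtain i j k l where ij: "x = (i, j)" "y = (k, l)" by (cases x, cases y)
  have "coord k (traceless_unit b (i, j) l) = coord k (traceless_unit b (k, l) l)"
    using eq ij by simp
  thus "x = y" using x y ij assms by (auto simp: coord_traceless_unit split: if_splits)
qed

lemma card_traceless_units:
  assumes "b \<in> Basis"
  shows "finite (traceless_units b) \<and> card (traceless_units b) = (card Basis)\<^sup>2 - 1"
  unfolding traceless_units_def using assms finite_Basis
  by (simp add: card_image inj_on_traceless_unit card_cartesian_product power2_eq_square)

lemma independent_traceless_units:
  assumes b: "b \<in> Basis"
  shows "endo.independent (traceless_units b)"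
  unfolding endo.dependent_def
proof
  assume "\<exists>h\<in>traceless_units b. h \<in> endo.span (traceless_units b - {h})"
  then obtain k l where kl: "k \<in> Basis" "l \<in> Basis" "(k, l) \<noteq> (b, b)"
    and sp: "traceless_unit b (k, l) \<in> endo.span (traceless_units b - {traceless_unit b (k, l)})"
    by (auto simp: traceless_units_def)
  have "endo.subspace {h. coord k (h l) = 0}"
    by (auto simp: endo.subspace_def lin_form_add[OF lin_form_coord] lin_form_scale[OF lin_form_coord]
        lin_form_zero[OF lin_form_coord])
  moreover have "traceless_units b - {traceless_unit b (k, l)} \<subseteq> {h. coord k (h l) = 0}"
  proof
    fix h assume "h \<in> traceless_units b - {traceless_unit b (k, l)}"
    then obtain i j where "i \<in> Basis" "j \<in> Basis" "h = traceless_unit b (i, j)" "(i, j) \<noteq> (k, l)"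
      by (auto simp: traceless_units_def)
    thus "h \<in> {h. coord k (h l) = 0}"
      using coord_traceless_unit[of b i j k l] kl b by auto
  qed
  ultimately have "traceless_unit b (k, l) \<in> {h. coord k (h l) = 0}"
    using sp endo.span_minimal by blast
  thus False using kl b by (simp add: coord_traceless_unit)
qed

text \<open>The matrix entries of \<open>tensor v f\<close> are \<open>coord i v * f j\<close>.
  Replacing matrix units by traceless ones subtracts the trace \<open>f v\<close> at position
  \<open>(b, b)\<close>, and this is zero.\<close>

lemma tensor_in_span_traceless_units:
  assumes b: "b \<in> Basis" and f: "lin_form f" "f v = 0"
  shows "tensor v f \<in> endo.span (traceless_units b)"
proof -
  let ?M = "traceless_unit b"
  have "tensor v f = (\<Sum>i\<in>Basis. \<Sum>j\<in>Basis. (\<lambda>x. scale (coord i v * f j) (?M (i, j) x)))"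
  proof
    fix x
    have "(\<Sum>i\<in>Basis. \<Sum>j\<in>Basis. (\<lambda>x. scale (coord i v * f j) (?M (i, j) x))) x =
      (\<Sum>i\<in>Basis. \<Sum>j\<in>Basis. scale (coord i v * f j) (scale (coord j x) i) -
         (if i = j then scale (coord i v * f j) (scale (coord b x) b) else 0))"
      by (auto simp: traceless_unit_def tensor_def scale_right_diff_distrib sum_fun_apply intro!: sum.cong)
    also have "\<dots> = (\<Sum>i\<in>Basis. \<Sum>j\<in>Basis. scale (f j * coord j x) (scale (coord i v) i)) -
        (\<Sum>i\<in>Basis. scale (f i * coord i v) (scale (coord b x) b))"
      using finite_Basis by (simp add: sum_subtractf mult_ac)
    also have "\<dots> = scale (f x) (\<Sum>i\<in>Basis. scale (coord i v) i) - scale (f v) (scale (coord b x) b)"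
      by (simp only: lin_form_expand[OF f(1), of x] lin_form_expand[OF f(1), of v] scale_sum_left
          scale_sum_right)
    finally show "tensor v f x = (\<Sum>i\<in>Basis. \<Sum>j\<in>Basis. (\<lambda>x. scale (coord i v * f j) (?M (i, j) x))) x"
      using f by (simp add: tensor_def sum_coord)
  qed
  also have "\<dots> \<in> endo.span (traceless_units b)"
  proof (intro endo.span_sum endo.span_scale)
    fix i j assume ij: "i \<in> Basis" "j \<in> Basis"
    show "?M (i, j) \<in> endo.span (traceless_units b)"
    proof (cases "(i, j) = (b, b)")
      case True
      hence "?M (i, j) = 0" by (simp add: traceless_unit_def)
      thus ?thesis using endo.span_zero by simp
    next
      case False
      thus ?thesis using ij by (intro endo.span_base) (auto simp: traceless_units_def)
    qed
  qed
  finally show ?thesis .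
qed

text \<open>Off-diagonal units are themselves tensors of flags. A diagonal difference comes from the
  vector \<open>i + b\<close> and the form \<open>coord i - coord b\<close> by cancelling the two
  off-diagonal terms.\<close>

lemma traceless_units_in_span_tensors:
  assumes b: "b \<in> Basis"
  shows "traceless_units b \<subseteq> endo.span {tensor v f | v f. v \<noteq> 0 \<and> lin_form f \<and> (\<exists>x. f x \<noteq> 0) \<and> f v = 0}"
    (is "_ \<subseteq> endo.span ?T")
proof -
  have off: "tensor i (coord j) \<in> ?T" if "i \<in> Basis" "j \<in> Basis" "i \<noteq> j" for i j
  proof -
    have "coord i i \<noteq> 0" "coord j j \<noteq> 0" "coord j i = 0" using that by (auto simp: coord_basis)
    moreover from this have "i \<noteq> 0" using lin_form_zero[OF lin_form_coord, of i] by auto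
    ultimately show ?thesis using lin_form_coord by blast
  qed
  have diag: "tensor i (coord i) - tensor b (coord b) \<in> endo.span ?T" if i: "i \<in> Basis" "i \<noteq> b" for i
  proof -
    let ?f = "\<lambda>x. 1 * coord i x + (-1) * coord b x"
    have "lin_form ?f" by (intro lin_form_lincomb lin_form_coord)
    moreover have "?f i \<noteq> 0" "?f (i + b) = 0"
      using i b by (auto simp: coord_basis lin_form_add[OF lin_form_coord])
    moreover have "coord i (i + b) = 1"
      using i b by (auto simp: coord_basis lin_form_add[OF lin_form_coord])
    hence "i + b \<noteq> 0" using lin_form_zero[OF lin_form_coord, of i] by auto
    ultimately have "tensor (i + b) ?f \<in> ?T" by blast
    hence "tensor (i + b) ?f + tensor i (coord b) - tensor b (coord i) \<in> endo.span ?T"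
      using off[of i b] off[of b i] i b
      by (intro endo.span_add endo.span_diff endo.span_base) auto
    also have "tensor (i + b) ?f + tensor i (coord b) - tensor b (coord i) =
        tensor i (coord i) - tensor b (coord b)"
      by (simp add: tensor_def fun_eq_iff scale_left_diff_distrib scale_right_distrib)
    finally show ?thesis .
  qed
  show ?thesis
  proof
    fix h assume "h \<in> traceless_units b"
    then obtain i j where ij: "i \<in> Basis" "j \<in> Basis" "(i, j) \<noteq> (b, b)" "h = traceless_unit b (i, j)"
      by (auto simp: traceless_units_def)
    show "h \<in> endo.span ?T"
    proof (cases "i = j")
      case True
      thus ?thesis using ij diag[of i] by (simp add: traceless_unit_def)
    next
      case False
      hence "h = tensor i (coord j)" using ij by (simp add: traceless_unit_def)
      thus ?thesis using endo.span_base[OF off[OF ij(1,2) False]] by (simp only:)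
    qed
  qed
qed

section \<open>From flags to one-dimensional spaces of tensors\<close>

lemma lin_form_eq_scaled:
  assumes f: "lin_form f" "f y \<noteq> 0" and h: "lin_form h" and ker: "\<And>x. f x = 0 \<Longrightarrow> h x = 0"
  shows "h = (\<lambda>x. (h y / f y) * f x)"
proof
  fix x
  have "f (x - scale (f x / f y) y) = 0" using f by (simp add: lin_form_diff lin_form_scale)
  hence "h (x - scale (f x / f y) y) = 0" by (rule ker)
  thus "h x = (h y / f y) * f x" using h by (simp add: lin_form_diff lin_form_scale)
qed

text \<open>Choose \<open>y\<close> outside \<open>S\<close> and \<open>z\<close> outside the span
  of \<open>S\<close> and \<open>y\<close>. The kernels of the two forms are spanned by
  \<open>S\<close> with \<open>y\<close> and by \<open>S\<close> with \<open>z\<close>.\<close>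

lemma codim_2_is_intersection_of_kernels:
  assumes S: "subspace S" "card Basis = dim S + 2"
  obtains f h y z where "lin_form f" "lin_form h" "f y = 0" "h y \<noteq> 0" "f z \<noteq> 0" "h z = 0"
    "\<And>x. x \<in> S \<Longrightarrow> f x = 0 \<and> h x = 0"
    "\<And>k. lin_form k \<Longrightarrow> \<forall>x\<in>S. k x = 0 \<Longrightarrow> \<exists>a b. k = (\<lambda>x. a * f x + b * h x)"
proof -
  have sS: "span S \<subseteq> S" by (rule span_minimal[OF subset_refl S(1)])
  have "S \<noteq> UNIV" using S(2) by (auto simp: dim_UNIV)
  then obtain y where y: "y \<notin> S" by blast
  let ?H1 = "span (insert y S)"
  have d1: "dim ?H1 = dim S + 1" using y sS by (auto simp: dim_insert)
  have "?H1 \<noteq> UNIV"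
  proof
    assume "?H1 = UNIV"
    hence "dim ?H1 = dim (UNIV :: 'b set)" by (simp only:)
    thus False using d1 S(2) dim_UNIV by linarith
  qed
  then obtain z where z: "z \<notin> ?H1" by blast
  let ?H2 = "span (insert z S)"
  have "z \<notin> span S" using z span_mono[of S "insert y S"] by blast
  hence d2: "dim ?H2 = dim S + 1" by (simp add: dim_insert)
  obtain f where f: "lin_form f" "?H1 = {x. f x = 0}"
    using hyperplane_is_kernel[OF subspace_span, of "insert y S"] d1 S(2) by auto
  obtain h where h: "lin_form h" "?H2 = {x. h x = 0}"
    using hyperplane_is_kernel[OF subspace_span, of "insert z S"] d2 S(2) by auto
  have "y \<notin> ?H2"
  proof
    assume "y \<in> ?H2"
    moreover have "y \<notin> span S" using y sS by blast
    ultimately have "z \<in> span (insert y S)" by (rule in_span_insert)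
    with z show False by simp
  qed
  hence fy: "f y = 0" "h y \<noteq> 0" "f z \<noteq> 0" "h z = 0"
    using f h z span_base[of y "insert y S"] span_base[of z "insert z S"] by auto
  have fS: "f x = 0 \<and> h x = 0" if "x \<in> S" for x
    using f(2) h(2) span_base[of x "insert y S"] span_base[of x "insert z S"] that by auto
  have ex: "\<exists>a b. k = (\<lambda>x. a * f x + b * h x)" if k: "lin_form k" "\<forall>x\<in>S. k x = 0" for k
  proof -
    \<comment> \<open>The subtracted combination agrees with \<open>k\<close> at \<open>y\<close>
      and \<open>z\<close>, so the difference vanishes on \<open>S\<close>, \<open>y\<close> and
      \<open>z\<close>, which together span the space.\<close>
    let ?r = "\<lambda>x. 1 * k x + (-1) * ((k z / f z) * f x + (k y / h y) * h x)"
    have r: "lin_form ?r" using k f h by (intro lin_form_lincomb)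
    have "insert z (insert y S) \<subseteq> {x. ?r x = 0}" using fy fS k by auto
    hence "span (insert z (insert y S)) \<subseteq> {x. ?r x = 0}"
      by (rule span_minimal) (rule subspace_kernel[OF r])
    moreover have "dim (insert z (insert y S)) = card Basis"
      using z d1 S(2) by (simp add: dim_insert)
    hence "span (insert z (insert y S)) = UNIV"
      using dim_eq_full[of "insert z (insert y S)"] by (simp add: dimension_def)
    ultimately have r0: "?r x = 0" for x by blast
    have "k x = (k z / f z) * f x + (k y / h y) * h x" for x
      using r0[of x] unfolding mult_1_left mult_minus1 add_uminus_conv_diff right_minus_eq .
    thus ?thesis by blast
  qed
  show thesis by (rule that[OF f(1) h(1) fy fS ex])
qed

text \<open>Built from the subspaces \<open>p\<close> and \<open>H\<close> rather than from
  representatives, so that no choice of vector and form has to be justified.\<close>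

definition tensors_of_flag :: "'b set \<times> 'b set \<Rightarrow> ('b \<Rightarrow> 'b) set" where
  "tensors_of_flag = (\<lambda>(p, H). {tensor v f | v f. v \<in> p \<and> lin_form f \<and> (\<forall>x\<in>H. f x = 0)})"

text \<open>A form vanishing on the kernel of \<open>f\<close> is a multiple of \<open>f\<close>, so
  all these tensors are multiples of one.\<close>

lemma tensors_of_flag:
  assumes "lin_form f" "f y \<noteq> 0"
  shows "tensors_of_flag (flag v f) = endo.span {tensor v f}"
proof (intro equalityI subsetI)
  fix t assume "t \<in> tensors_of_flag (flag v f)"
  then obtain w h where t: "t = tensor w h" "w \<in> span {v}" "lin_form h" "\<And>x. f x = 0 \<Longrightarrow> h x = 0"
    by (auto simp: tensors_of_flag_def flag_def)
  obtain c where c: "w = scale c v" using t(2) by (auto simp: span_singleton)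
  have "h = (\<lambda>x. (h y / f y) * f x)" by (rule lin_form_eq_scaled[OF assms t(3,4)])
  then obtain d where d: "h = (\<lambda>x. d * f x)" by blast
  have "t = (\<lambda>x. scale (c * d) (tensor v f x))"
    by (simp add: t(1) c d tensor_def mult_ac)
  thus "t \<in> endo.span {tensor v f}" by (auto simp: endo.span_singleton)
next
  fix t assume "t \<in> endo.span {tensor v f}"
  then obtain c where "t = (\<lambda>x. scale c (tensor v f x))" by (auto simp: endo.span_singleton)
  hence "t = tensor (scale c v) f" by (simp add: tensor_scale_left)
  moreover have "scale c v \<in> span {v}" by (intro span_scale span_base) simp
  ultimately show "t \<in> tensors_of_flag (flag v f)"
    using assms by (auto simp: tensors_of_flag_def flag_def)
qed

text \<open>The point is recovered as the set of values of the tensors and the hyperplane as their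
  common zero set. This gives injectivity of the embedding.\<close>

lemma flag_of_tensors:
  assumes "lin_form f" "f y \<noteq> 0" "v \<noteq> 0"
  shows "flag v f = ({h x | h x. h \<in> tensors_of_flag (flag v f)},
    {x. \<forall>h\<in>tensors_of_flag (flag v f). h x = 0})"
proof -
  have T: "tensors_of_flag (flag v f) = {\<lambda>x. scale c (tensor v f x) | c. True}"
    using tensors_of_flag[OF assms(1,2), of v] by (auto simp: endo.span_singleton)
  have A: "span {v} = {h x | h x. h \<in> tensors_of_flag (flag v f)}"
  proof (intro equalityI subsetI)
    fix u assume "u \<in> span {v}"
    then obtain c where "u = scale c v" by (auto simp: span_singleton)
    hence "u = scale (c / f y) (tensor v f y)" using assms by (simp add: tensor_def)
    thus "u \<in> {h x | h x. h \<in> tensors_of_flag (flag v f)}"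
      unfolding T by (intro CollectI exI[of _ "\<lambda>x. scale (c / f y) (tensor v f x)"] exI[of _ y]) auto
  qed (auto simp: T tensor_def span_singleton)
  have B: "f x = 0 \<longleftrightarrow> (\<forall>h\<in>tensors_of_flag (flag v f). h x = 0)" for x
  proof
    have "tensor v f \<in> tensors_of_flag (flag v f)"
      using tensors_of_flag[OF assms(1,2), of v] endo.span_base by auto
    moreover assume "\<forall>h\<in>tensors_of_flag (flag v f). h x = 0"
    ultimately have "tensor v f x = 0" by blast
    thus "f x = 0" using assms(3) by (simp add: tensor_def)
  qed (auto simp: T tensor_def)
  show ?thesis unfolding A[symmetric] B[symmetric] by (rule flag_def)
qed

lemma inj_on_tensors_of_flag:
  assumes "card Basis = n + 1"
  shows "inj_on tensors_of_flag (points (flag_geometry n))"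
proof (rule inj_onI)
  fix z w assume zw: "z \<in> points (flag_geometry n)" "w \<in> points (flag_geometry n)"
    and eq: "tensors_of_flag z = tensors_of_flag w"
  have "z = ({h x | h x. h \<in> tensors_of_flag z}, {x. \<forall>h\<in>tensors_of_flag z. h x = 0})"
    if "z \<in> points (flag_geometry n)" for z
    using that flag_of_tensors unfolding points_flag_geometry[OF assms] by blast
  from this[OF zw(1)] this[OF zw(2)] eq show "z = w" by simp
qed

context
  fixes n and f :: "'a \<Rightarrow> 'd" and g :: "('b \<Rightarrow> 'b) \<Rightarrow> 'w" and b
  assumes n: "card Basis = n + 1" "n \<ge> 2" and b: "b \<in> Basis" and f: "inj f"
    and g: "inj_on g (endo.span (traceless_units b))"
begin

private abbreviation "traceless \<equiv> endo.span (traceless_units b)"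
private abbreviation "traceless_space \<equiv> endo.image_space f g traceless"

lemmas image_facts = f g endo.subspace_span[of "traceless_units b"]

text \<open>A common criterion for both kinds of lines: the flags on the line must correspond to the
  nonzero combinations of two independent elements.\<close>

lemma tensors_line_image:
  assumes h: "h1 \<in> traceless" "h2 \<in> traceless"
    and ind: "\<And>a c. (\<lambda>x. scale a (h1 x)) + (\<lambda>x. scale c (h2 x)) = 0 \<Longrightarrow> a = 0 \<and> c = 0"
    and l1: "\<And>z. z \<in> l \<Longrightarrow> \<exists>a c. (a \<noteq> 0 \<or> c \<noteq> 0) \<and>
      tensors_of_flag z = endo.span {(\<lambda>x. scale a (h1 x)) + (\<lambda>x. scale c (h2 x))}"
    and l2: "\<And>a c. a \<noteq> 0 \<or> c \<noteq> 0 \<Longrightarrow> \<exists>z\<in>l.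
      tensors_of_flag z = endo.span {(\<lambda>x. scale a (h1 x)) + (\<lambda>x. scale c (h2 x))}"
  shows "(\<lambda>z. g ` tensors_of_flag z) ` l \<in> lines (PG (image_field f) traceless_space)"
proof -
  have "(\<lambda>z. g ` tensors_of_flag z) ` l =
    {g ` endo.span {(\<lambda>x. scale a (h1 x)) + (\<lambda>x. scale c (h2 x))} | a c. a \<noteq> 0 \<or> c \<noteq> 0}"
    (is "?A = ?B")
  proof (intro equalityI subsetI)
    fix x assume "x \<in> ?A"
    then obtain z where "z \<in> l" "x = g ` tensors_of_flag z" by blast
    thus "x \<in> ?B" using l1[of z] by auto
  next
    fix x assume "x \<in> ?B"
    then obtain a c where ac: "a \<noteq> 0 \<or> c \<noteq> 0"
      "x = g ` endo.span {(\<lambda>x. scale a (h1 x)) + (\<lambda>x. scale c (h2 x))}" by blast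
    then obtain z where "z \<in> l" "x = g ` tensors_of_flag z" using l2[OF ac(1)] by metis
    thus "x \<in> ?A" by blast
  qed
  thus ?thesis using endo.PG_line_image[OF image_facts h ind] by simp
qed

lemma projective_embedding_tensors:
  "projective_embedding (flag_geometry n) (image_field f) traceless_space (\<lambda>z. g ` tensors_of_flag z)"
  unfolding projective_embedding_def
proof (intro conjI ballI)
  note P = points_flag_geometry[OF n(1)]
  have in_U: "tensor v k \<in> traceless" if "lin_form k" "k v = 0" for v k
    by (rule tensor_in_span_traceless_units[OF b that])
  show "left_vector_space (image_field f) traceless_space"
    by (rule endo.left_vector_space_image_space[OF image_facts])
  have TU: "tensors_of_flag z \<subseteq> traceless" if zP: "z \<in> points (flag_geometry n)" for z
  proof -
    obtain v k x where z: "z = flag v k" "lin_form k" "k x \<noteq> 0" "k v = 0" using zP unfolding P by blast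
    have "endo.span {tensor v k} \<subseteq> traceless"
      by (rule endo.span_minimal) (use in_U[OF z(2,4)] endo.subspace_span in auto)
    thus ?thesis using tensors_of_flag[OF z(2,3), of v] z(1) by simp
  qed
  show "(\<lambda>z. g ` tensors_of_flag z) ` points (flag_geometry n) \<subseteq>
      points (PG (image_field f) traceless_space)"
  proof (rule image_subsetI)
    fix z assume "z \<in> points (flag_geometry n)"
    then obtain v k x where z: "z = flag v k" "v \<noteq> 0" "lin_form k" "k x \<noteq> 0" "k v = 0" unfolding P by blast
    have "tensor v k \<noteq> 0" using z tensor_eq_0_iff by blast
    thus "g ` tensors_of_flag z \<in> points (PG (image_field f) traceless_space)"
      unfolding endo.PG_points_image[OF image_facts]
      using z(1) tensors_of_flag[OF z(3,4), of v] in_U[OF z(3,5)] by blast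
  qed
  show "inj_on (\<lambda>z. g ` tensors_of_flag z) (points (flag_geometry n))"
  proof (rule inj_onI)
    fix z w assume zw: "z \<in> points (flag_geometry n)" "w \<in> points (flag_geometry n)"
      and "g ` tensors_of_flag z = g ` tensors_of_flag w"
    hence "tensors_of_flag z = tensors_of_flag w"
      using inj_on_image_eq_iff[OF g TU TU] by blast
    thus "z = w" using inj_on_tensors_of_flag[OF n(1)] zw by (auto dest: inj_onD)
  qed
  show "lin_span (image_field f) traceless_space
      (\<Union>((\<lambda>z. g ` tensors_of_flag z) ` points (flag_geometry n))) = carrier traceless_space"
  proof -
    \<comment> \<open>The tensors of all flags span the traceless units and are spanned by
      them.\<close>
    let ?A = "\<Union>(tensors_of_flag ` points (flag_geometry n))"
    have A: "?A \<subseteq> traceless" using TU by blast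
    have "{tensor v f | v f. v \<noteq> 0 \<and> lin_form f \<and> (\<exists>x. f x \<noteq> 0) \<and> f v = 0} \<subseteq> ?A"
    proof
      fix t assume "t \<in> {tensor v f | v f. v \<noteq> 0 \<and> lin_form f \<and> (\<exists>x. f x \<noteq> 0) \<and> f v = 0}"
      then obtain v k x where t: "t = tensor v k" "v \<noteq> 0" "lin_form k" "k x \<noteq> 0" "k v = 0" by blast
      have "t \<in> tensors_of_flag (flag v k)"
        using tensors_of_flag[OF t(3,4), of v] t(1) endo.span_base by auto
      moreover have "flag v k \<in> points (flag_geometry n)" unfolding P using t by blast
      ultimately show "t \<in> ?A" by blast
    qed
    hence "endo.span {tensor v f | v f. v \<noteq> 0 \<and> lin_form f \<and> (\<exists>x. f x \<noteq> 0) \<and> f v = 0} \<subseteq> endo.span ?A"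
      by (rule endo.span_mono)
    hence "traceless_units b \<subseteq> endo.span ?A"
      using traceless_units_in_span_tensors[OF b] by (rule subset_trans[rotated])
    hence "traceless \<subseteq> endo.span ?A" by (rule endo.span_minimal) (rule endo.subspace_span)
    moreover have "endo.span ?A \<subseteq> traceless" using A by (rule endo.span_minimal) (rule endo.subspace_span)
    ultimately have "lin_span (image_field f) traceless_space (g ` ?A) = g ` traceless"
      using endo.lin_span_image[OF image_facts A] by simp
    moreover have "g ` ?A = \<Union>((\<lambda>z. g ` tensors_of_flag z) ` points (flag_geometry n))" by blast
    ultimately show ?thesis by (simp add: endo.image_space_def)
  qed
  fix l assume "l \<in> lines (flag_geometry n)"
  then consider
    (pencil) p S where "subspace p" "dim p = 1" "subspace S" "dim S = n - 1" "p \<subseteq> S"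
      "l = {(p, Z) | Z. subspace Z \<and> dim Z = n \<and> S \<subseteq> Z}"
  | (range) L H where "subspace L" "dim L = 2" "subspace H" "dim H = n" "L \<subseteq> H"
      "l = {(x, H) | x. subspace x \<and> dim x = 1 \<and> x \<subseteq> L}"
    unfolding flag_geometry_def by auto
  thus "(\<lambda>z. g ` tensors_of_flag z) ` l \<in> lines (PG (image_field f) traceless_space)"
  proof cases
    case pencil
    \<comment> \<open>On a pencil the vector is fixed and the form runs through the two-dimensional
      space of forms vanishing on \<open>S\<close>.\<close>
    obtain v where v: "v \<noteq> 0" "p = span {v}" using dim_1_is_span pencil by blast
    have "card Basis = dim S + 2" using n pencil by simp
    thus ?thesis
    proof (rule codim_2_is_intersection_of_kernels[OF pencil(3)])
      fix k1 k2 y z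
      assume k: "lin_form k1" "lin_form k2" "k1 y = 0" "k2 y \<noteq> 0" "k1 z \<noteq> 0" "k2 z = 0"
        "\<And>x. x \<in> S \<Longrightarrow> k1 x = 0 \<and> k2 x = 0"
        "\<And>k. lin_form k \<Longrightarrow> \<forall>x\<in>S. k x = 0 \<Longrightarrow> \<exists>a b. k = (\<lambda>x. a * k1 x + b * k2 x)"
      have vS: "v \<in> S" using pencil(5) v span_base[of v "{v}"] by blast
      let ?k = "\<lambda>a c x. a * k1 x + c * k2 x"
      have lk: "lin_form (?k a c)" for a c using k by (intro lin_form_lincomb)
      have nz: "\<exists>x. ?k a c x \<noteq> 0" if "a \<noteq> 0 \<or> c \<noteq> 0" for a c
        using that k(3-6) by (metis add.right_neutral add_0 mult_eq_0_iff)
      show ?thesis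
      proof (rule tensors_line_image)
        show "tensor v k1 \<in> traceless" "tensor v k2 \<in> traceless" using in_U k vS by auto
      next
        fix a c assume "(\<lambda>x. scale a (tensor v k1 x)) + (\<lambda>x. scale c (tensor v k2 x)) = 0"
        hence "tensor v (?k a c) = 0" by (simp add: tensor_lincomb_right)
        hence "\<forall>x. ?k a c x = 0" using tensor_eq_0_iff[of v "?k a c"] v by simp
        thus "a = 0 \<and> c = 0" using nz[of a c] by auto
      next
        fix z assume "z \<in> l"
        then obtain Z where Z: "z = (p, Z)" "subspace Z" "dim Z = n" "S \<subseteq> Z" using pencil(6) by blast
        obtain h x where h: "lin_form h" "h x \<noteq> 0" "Z = {y. h y = 0}"
          using hyperplane_is_kernel[OF Z(2)] Z(3) n by auto
        have "\<forall>x\<in>S. h x = 0" using Z(4) h(3) by auto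
        from k(8)[OF h(1) this] obtain a c where ac: "h = ?k a c" by (elim exE)
        have "tensors_of_flag z = endo.span {tensor v h}"
          using tensors_of_flag[OF h(1,2), of v] Z v h by (simp add: flag_def)
        moreover have "a \<noteq> 0 \<or> c \<noteq> 0" using h(2) ac by auto
        ultimately show "\<exists>a c. (a \<noteq> 0 \<or> c \<noteq> 0) \<and> tensors_of_flag z =
            endo.span {(\<lambda>x. scale a (tensor v k1 x)) + (\<lambda>x. scale c (tensor v k2 x))}"
          unfolding ac tensor_lincomb_right by (intro exI[of _ a] exI[of _ c] conjI)
      next
        fix a c :: 'a assume ac: "a \<noteq> 0 \<or> c \<noteq> 0"
        obtain x where x: "?k a c x \<noteq> 0" using nz[OF ac] by (elim exE)
        have "S \<subseteq> {y. ?k a c y = 0}" using k(7) by auto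
        moreover have "dim {y. ?k a c y = 0} = n" using dim_kernel[OF lk x] n by simp
        ultimately have "flag v (?k a c) \<in> l"
          unfolding pencil(6) flag_def v(2) using subspace_kernel[OF lk, of a c] by simp
        thus "\<exists>z\<in>l. tensors_of_flag z =
            endo.span {(\<lambda>x. scale a (tensor v k1 x)) + (\<lambda>x. scale c (tensor v k2 x))}"
          using tensors_of_flag[OF lk x, of v] unfolding tensor_lincomb_right by (rule bexI[rotated])
      qed
    qed
  next
    case range
    \<comment> \<open>On the other lines the form is fixed and the vector runs through
      \<open>L\<close>.\<close>
    obtain h x where h: "lin_form h" "h x \<noteq> 0" "H = {y. h y = 0}"
      using hyperplane_is_kernel[OF range(3)] range(4) n by auto
    obtain B where B: "B \<subseteq> L" "independent B" "L \<subseteq> span B" "card B = dim L"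
      by (rule basis_exists)
    then obtain v w where vw: "B = {v, w}" "v \<noteq> w" using range by (auto simp: card_2_iff)
    have L: "L = span {v, w}" using B vw range(1) span_minimal[of B L] by auto
    have h0: "h v = 0" "h w = 0" using B vw range(5) h(3) by auto
    have ind: "a = 0 \<and> c = 0" if "scale a v + scale c w = 0" for a c
    proof -
      have 1: "v \<notin> span {w}" using B(2) vw by (auto simp: independent_insert)
      have "a = 0"
      proof (rule ccontr)
        assume a: "a \<noteq> 0"
        have "scale a v = scale (- c) w" using that by (simp add: eq_neg_iff_add_eq_0)
        hence "scale (inverse a) (scale a v) = scale (inverse a) (scale (- c) w)" by (simp only:)
        also have "\<dots> \<in> span {w}" by (intro span_scale span_base) simp
        finally show False using 1 a by simp
      qed
      moreover have "w \<noteq> 0" using B(2) vw dependent_zero by blast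
      ultimately show ?thesis using that by auto
    qed
    have el: "\<exists>a c. u = scale a v + scale c w" if "u \<in> L" for u
      using that unfolding L by (auto simp: span_insert span_singleton) (metis add.commute diff_add_cancel)
    show ?thesis
    proof (rule tensors_line_image)
      show "tensor v h \<in> traceless" "tensor w h \<in> traceless" using in_U h h0 by auto
    next
      fix a c assume "(\<lambda>x. scale a (tensor v h x)) + (\<lambda>x. scale c (tensor w h x)) = 0"
      hence "tensor (scale a v + scale c w) h = 0" by (simp add: tensor_lincomb_left)
      hence "scale a v + scale c w = 0"
        using tensor_eq_0_iff[of "scale a v + scale c w" h] h(2) by auto
      thus "a = 0 \<and> c = 0" by (rule ind)
    next
      fix z assume "z \<in> l"
      then obtain q where q: "z = (q, H)" "subspace q" "dim q = 1" "q \<subseteq> L" using range(6) by blast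
      obtain u where u: "u \<noteq> 0" "q = span {u}" using dim_1_is_span q by blast
      have "u \<in> L" using q(4) u span_base[of u "{u}"] by blast
      from el[OF this] obtain a c where ac: "u = scale a v + scale c w" by (elim exE)
      have "tensors_of_flag z = endo.span {tensor u h}"
        using tensors_of_flag[OF h(1,2), of u] q u h by (simp add: flag_def)
      moreover have "a \<noteq> 0 \<or> c \<noteq> 0" using u ac by auto
      ultimately show "\<exists>a c. (a \<noteq> 0 \<or> c \<noteq> 0) \<and> tensors_of_flag z =
          endo.span {(\<lambda>x. scale a (tensor v h x)) + (\<lambda>x. scale c (tensor w h x))}"
        unfolding ac tensor_lincomb_left by (intro exI[of _ a] exI[of _ c] conjI)
    next
      fix a c :: 'a assume ac: "a \<noteq> 0 \<or> c \<noteq> 0"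
      let ?u = "scale a v + scale c w"
      have "?u \<noteq> 0" using ind[of a c] ac by auto
      hence "dim (span {?u}) = 1" by simp
      moreover have "?u \<in> L" unfolding L by (intro span_add span_scale span_base) auto
      hence "span {?u} \<subseteq> L" using range(1) by (intro span_minimal) auto
      ultimately have "flag ?u h \<in> l" unfolding range(6) flag_def h(3)[symmetric]
        using subspace_span[of "{?u}"] by simp
      thus "\<exists>z\<in>l. tensors_of_flag z =
          endo.span {(\<lambda>x. scale a (tensor v h x)) + (\<lambda>x. scale c (tensor w h x))}"
        using tensors_of_flag[OF h(1,2), of ?u] unfolding tensor_lincomb_left by (rule bexI[rotated])
    qed
  qed
qed

lemma lin_dim_traceless_space:
  "lin_dim (image_field f) traceless_space (carrier traceless_space) = enat ((n + 1)\<^sup>2 - 1)"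
proof -
  have "lin_dim (image_field f) traceless_space (g ` traceless) = enat (card (traceless_units b))"
    using card_traceless_units[OF b] independent_traceless_units[OF b] endo.span_superset
    by (intro endo.lin_dim_image[OF image_facts]) auto
  thus ?thesis using card_traceless_units[OF b] n by (simp add: endo.image_space_def)
qed

end

end

section \<open>The embedding rank\<close>

lemma (in vector_space) countable_span:
  assumes "countable (UNIV :: 'a set)" "finite S"
  shows "countable (span S)"
  using assms(2)
proof induction
  case (insert a S)
  have "span (insert a S) \<subseteq> (\<lambda>(k, y). y + scale k a) ` (UNIV \<times> span S)"
    by (force simp: span_insert)
  thus ?case using insert assms(1) by (meson countable_SIGMA countable_image countable_subset)
qed simp

lemma countable_imp_inj_on_infinite_type:
  assumes "countable A" "infinite (UNIV :: 'd set)"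
  shows "\<exists>f :: 'a \<Rightarrow> 'd. inj_on f A"
proof -
  obtain h :: "nat \<Rightarrow> 'd" where "inj h" using infinite_countable_subset[OF assms(2)] by blast
  hence "inj_on (h \<circ> to_nat_on A) A"
    using inj_on_to_nat_on[OF assms(1)] by (auto intro: comp_inj_on inj_on_subset)
  thus ?thesis by blast
qed

text \<open>The bound holds over every division ring, because it rests on dependence of points
  inside the geometry.\<close>

lemma (in finite_dimensional_vector_space) embedding_rank_flag_geometry_le:
  assumes n: "card Basis = n + 1" "n \<ge> 2"
    and gen: "\<And>T :: 'a set. finite T \<Longrightarrow> \<exists>t. \<forall>x\<in>T. x = 0 \<or> (\<exists>m. x = t ^ m)"
  shows "embedding_rank TYPE('d) TYPE('w) (flag_geometry n) \<le> enat ((n + 1)\<^sup>2)"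
  unfolding embedding_rank_def
proof (rule Sup_least)
  fix d
  assume "d \<in> {lin_dim R W (carrier W) | (R :: 'd ring) (W :: ('d, 'w) module) e.
    projective_embedding (flag_geometry n) R W e}"
  then obtain R :: "'d ring" and W :: "('d, 'w) module" and e where
    e: "projective_embedding (flag_geometry n) R W e" and d: "d = lin_dim R W (carrier W)" by blast
  interpret left_vector_space R W using e by (simp add: projective_embedding_def)
  show "d \<le> enat ((n + 1)\<^sup>2)"
    unfolding d using e lines_subset_points finite_flags_dependent[OF n gen]
    by (rule lin_dim_embedding_le)
qed

text \<open>The field and the span of the traceless units are countable, so both can be copied into
  any infinite types.\<close>

lemma (in finite_dimensional_vector_space) embedding_rank_flag_geometry_ge:
  assumes n: "card Basis = n + 1" "n \<ge> 2" and "countable (UNIV :: 'a set)"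
    and "infinite (UNIV :: 'd set)" "infinite (UNIV :: 'w set)"
  shows "enat ((n + 1)\<^sup>2 - 1) \<le> embedding_rank TYPE('d) TYPE('w) (flag_geometry n)"
proof -
  obtain b where b: "b \<in> Basis" using n by fastforce
  obtain f :: "'a \<Rightarrow> 'd" where f: "inj f"
    using countable_imp_inj_on_infinite_type assms(3,4) by blast
  have "countable (endo.span (traceless_units b))"
    using card_traceless_units[OF b] assms(3) by (intro endo.countable_span) auto
  then obtain g :: "('b \<Rightarrow> 'b) \<Rightarrow> 'w" where g: "inj_on g (endo.span (traceless_units b))"
    using countable_imp_inj_on_infinite_type assms(5) by blast
  show ?thesis
    unfolding embedding_rank_def
  proof (rule Sup_upper, intro CollectI exI conjI)
    show "projective_embedding (flag_geometry n) (image_field f)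
        (endo.image_space f g (endo.span (traceless_units b))) (\<lambda>z. g ` tensors_of_flag z)"
      by (rule projective_embedding_tensors[OF n b f g])
    show "enat ((n + 1)\<^sup>2 - 1) = lin_dim (image_field f)
        (endo.image_space f g (endo.span (traceless_units b)))
        (carrier (endo.image_space f g (endo.span (traceless_units b))))"
      by (rule lin_dim_traceless_space[OF n b f g, symmetric])
  qed
qed

theorem theorem1p5:
  fixes scale :: "'p::prime_card mod_ring alg_closure \<Rightarrow> 'v::ab_group_add \<Rightarrow> 'v"
    and n :: nat
  assumes "vector_space scale"
    and "vector_space.dim scale UNIV = n + 1"
    and "n \<ge> 3"
    and "infinite (UNIV :: 'd set)"
    and "infinite (UNIV :: 'w set)"
  shows "generating_rank (vector_space.flag_geometry scale n) = \<infinity> \<and>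
    (embedding_rank TYPE('d) TYPE('w) (vector_space.flag_geometry scale n) = enat ((n + 1)^2 - 1) \<or>
     embedding_rank TYPE('d) TYPE('w) (vector_space.flag_geometry scale n) = enat ((n + 1)^2))"
proof -
  interpret V: vector_space scale by fact
  obtain B where B: "V.independent B" "UNIV \<subseteq> V.span B" "card B = V.dim UNIV"
    using V.basis_exists[of UNIV] by blast
  have card_B: "card B = n + 1" and n2: "n \<ge> 2" using B(3) assms(2,3) by simp_all
  \<comment> \<open>\<open>card\<close> is \<open>0\<close> on infinite sets, so a positive value
    gives finiteness.\<close>
  have "finite B" using card_B by (intro card_ge_0_finite) simp
  interpret F: finite_dimensional_vector_space scale B
    by unfold_locales (use \<open>finite B\<close> B in auto)
  have hom: "\<exists>\<phi>. (\<forall>a b. \<phi> (a + b) = \<phi> a + \<phi> b) \<and> (\<forall>a b. \<phi> (a * b) = \<phi> a * \<phi> b) \<and>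
      (\<forall>a\<in>T. \<phi> a = a) \<and> (\<exists>a. \<phi> a \<noteq> a) \<and> \<phi> 1 = 1"
    if T: "finite T" for T :: "'p mod_ring alg_closure set"
  proof -
    obtain m where m: "m > 0" "\<forall>x\<in>T. x ^ (CARD('p) ^ m) = x"
      using finite_frobenius_fixes[OF T] by blast
    let ?q = "CARD('p) ^ m"
    \<comment> \<open>The homomorphism is the power map with exponent \<open>?q\<close>. It is not
      the identity, because it has finitely many fixed points in an infinite field.\<close>
    have "?q > 1" using m(1) prime_card[where 'a = 'p] by (intro one_less_power prime_gt_1_nat)
    hence "finite {x :: 'p mod_ring alg_closure. x ^ ?q = x}" by (rule finite_frobenius_fixed)
    hence "{x :: 'p mod_ring alg_closure. x ^ ?q = x} \<noteq> UNIV"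
      using infinite_UNIV_alg_closed_field[where 'a = "'p mod_ring alg_closure"] by metis
    hence "\<exists>x :: 'p mod_ring alg_closure. x ^ ?q \<noteq> x" by blast
    moreover have "(x + y) ^ ?q = x ^ ?q + y ^ ?q" for x y :: "'p mod_ring alg_closure"
      by (rule freshmans_dream') (simp_all add: prime_card)
    ultimately show ?thesis
      using m(2) by (intro exI[of _ "\<lambda>x. x ^ ?q"]) (simp add: power_mult_distrib)
  qed
  have gen: "\<exists>t. \<forall>x\<in>T. x = 0 \<or> (\<exists>m. x = t ^ m)"
    if T: "finite T" for T :: "'p mod_ring alg_closure set"
    using finite_frobenius_fixes[OF T] frobenius_fixed_generator by meson
  have "generating_rank (V.flag_geometry n) = \<infinity>"
    using F.infinite_generating_set[OF card_B n2 hom] by (intro generating_rank_eq_infinity)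
  moreover have "embedding_rank TYPE('d) TYPE('w) (V.flag_geometry n) \<le> enat ((n + 1)\<^sup>2)"
    by (rule F.embedding_rank_flag_geometry_le[OF card_B n2 gen])
  moreover have "enat ((n + 1)\<^sup>2 - 1) \<le> embedding_rank TYPE('d) TYPE('w) (V.flag_geometry n)"
    by (rule F.embedding_rank_flag_geometry_ge[OF card_B n2 countable_UNIV_alg_closure_finite assms(4,5)])
  \<comment> \<open>The rank is squeezed between two consecutive integers, which also excludes the
    infinite value.\<close>
  ultimately show ?thesis
    by (cases "embedding_rank TYPE('d) TYPE('w) (V.flag_geometry n)") auto
qed

end
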